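(* For every positive integer $n$, $$\mathsf{D}(\mathcal{M}_n) = \frac{n(n-1)}{2}, \qquad \mathsf{R}(\mathcal{M}_n) = \Theta(n^2), \qquad \mathsf{Q}(\mathcal{M}_n) = \Theta(n^{1.5}).$$
   Context: Let $\mathcal{M}_n$ be the set of all $n\times n$ permutation matrices, i.e. matrices obtained from the $n\times n$ identity matrix $I_n$ by permuting rows and/or columns. These are the bipartite adjacency matrices of perfect matchings between two copies of $[n]=\{1,\dots,n\}$. Learning a hidden graph means: an unknown matrix $M$ from a known family $\mathcal{X}_n$ of $n\times n$ 0-1 matrices is given by oracle access, where an edge query on $(i,j)\in[n]\times[n]$ returns the entry $M(i,j)$. The algorithm must output $M$. $\mathsf{D}(\mathcal{X}_n)$ is the minimum, over deterministic decision trees that output $M$ correctly for every $M\in\mathcal{X}_n$, of the worst-case number of queries. $\mathsf{R}(\mathcal{X}_n)$ is the minimum worst-case number of queries of a randomized algorithm (a probability distribution over deterministic decision trees) that outputs $M$ with probability at least $2/3$ for every $M\in\mathcal{X}_n$. $\mathsf{Q}(\mathcal{X}_n)$ is the minimum number of queries of a quantum query algorithm that outputs $M$ with probability at least $2/3$ for every $M\in\mathcal{X}_n$. Here a query is the unitary $|(i,j)\rangle|b\rangle\mapsto|(i,j)\rangle|b\oplus M(i,j)\rangle$, interleaved with input-independent unitaries, followed by a measurement. *)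

theory Defs
  imports
    "HOL-Probability.Probability_Mass_Function"
    "HOL-Combinatorics.Permutations"
    "HOL-Library.Landau_Symbols"
    "HOL-Library.Z2"
    "Jordan_Normal_Form.Matrix"
begin

text \<open>
  A 0-1 matrix is a matrix over the two-element field \<^typ>\<open>bit\<close>, whose addition is exclusive or.
  Rows and columns are indexed by \<open>{..<n}\<close> instead of \<open>{1..n}\<close>.
\<close>

definition perm_matrices :: "nat \<Rightarrow> bit mat set" where
  "perm_matrices n =
    {Matrix.mat n n (\<lambda>(i, j). 1\<^sub>m n $$ (\<pi> i, \<sigma> j)) | \<pi> \<sigma>.
       \<pi> permutes {..<n} \<and> \<sigma> permutes {..<n}}"


section \<open>Decision trees\<close>

text \<open>\<open>Query q t\<^sub>0 t\<^sub>1\<close> queries the entry \<open>q\<close> and continues with \<open>t\<^sub>0\<close> or \<open>t\<^sub>1\<close> on the answers 0 or 1.\<close>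

datatype dtree = Output "bit mat" | Query "nat \<times> nat" dtree dtree

fun dtree_on :: "nat \<Rightarrow> dtree \<Rightarrow> bool" where
  "dtree_on n (Output A) \<longleftrightarrow> True"
| "dtree_on n (Query q t\<^sub>0 t\<^sub>1) \<longleftrightarrow> q \<in> {..<n} \<times> {..<n} \<and> dtree_on n t\<^sub>0 \<and> dtree_on n t\<^sub>1"

fun dtree_out :: "dtree \<Rightarrow> bit mat \<Rightarrow> bit mat" where
  "dtree_out (Output A) M = A"
| "dtree_out (Query q t\<^sub>0 t\<^sub>1) M = (if M $$ q = 0 then dtree_out t\<^sub>0 M else dtree_out t\<^sub>1 M)"

fun dtree_cost :: "dtree \<Rightarrow> bit mat \<Rightarrow> nat" where
  "dtree_cost (Output A) M = 0"
| "dtree_cost (Query q t\<^sub>0 t\<^sub>1) M =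
    Suc (if M $$ q = 0 then dtree_cost t\<^sub>0 M else dtree_cost t\<^sub>1 M)"

text \<open>
  In the three complexity measures, \<open>X\<close> is a family of \<open>n \<times> n\<close> matrices, \<open>n \<ge> 1\<close>. The sets of attainable
  query counts are never empty for such families, since all \<open>n\<^sup>2\<close> entries can be queried;
  hence \<open>LEAST\<close> is a genuine minimum.
\<close>

definition D_query :: "nat \<Rightarrow> bit mat set \<Rightarrow> nat" where
  "D_query n X = (LEAST d. \<exists>t. dtree_on n t \<and>
     (\<forall>M\<in>X. dtree_out t M = M \<and> dtree_cost t M \<le> d))"

definition R_query :: "nat \<Rightarrow> bit mat set \<Rightarrow> nat" where
  "R_query n X = (LEAST d. \<exists>p :: dtree pmf.
     (\<forall>t\<in>set_pmf p. dtree_on n t \<and> (\<forall>M\<in>X. dtree_cost t M \<le> d)) \<and>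
     (\<forall>M\<in>X. measure_pmf.prob p {t. dtree_out t M = M} \<ge> 2 / 3))"


section \<open>Quantum query algorithms\<close>

text \<open>
  The Hilbert space of an algorithm with a workspace of dimension \<open>w\<close> has the orthonormal basis
  \<open>|(i,j)\<rangle>|b\<rangle>|a\<rangle>\<close> with \<open>i, j < n\<close>, \<open>b\<close> a bit and \<open>a < w\<close>. States and operators are given by
  their amplitudes and matrix entries in this basis; values outside of it are never used.
\<close>

type_synonym qbasis = "(nat \<times> nat) \<times> bit \<times> nat"
type_synonym qstate = "qbasis \<Rightarrow> complex"
type_synonym qoperator = "qbasis \<Rightarrow> qbasis \<Rightarrow> complex"

definition qspace :: "nat \<Rightarrow> nat \<Rightarrow> qbasis set" where
  "qspace n w = ({..<n} \<times> {..<n}) \<times> (UNIV \<times> {..<w})"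

text \<open>\<open>U\<^sup>* U = I\<close>, which on a finite-dimensional space also gives \<open>U U\<^sup>* = I\<close>.\<close>

definition qunitary :: "nat \<Rightarrow> nat \<Rightarrow> qoperator \<Rightarrow> bool" where
  "qunitary n w U \<longleftrightarrow> (\<forall>x\<in>qspace n w. \<forall>y\<in>qspace n w.
     (\<Sum>z\<in>qspace n w. cnj (U z x) * U z y) = (if x = y then 1 else 0))"

definition qapply :: "nat \<Rightarrow> nat \<Rightarrow> qoperator \<Rightarrow> qstate \<Rightarrow> qstate" where
  "qapply n w U \<psi> = (\<lambda>x. \<Sum>y\<in>qspace n w. U x y * \<psi> y)"

text \<open>
  The amplitudes after the query \<open>|q\<rangle>|b\<rangle>|a\<rangle> \<mapsto> |q\<rangle>|b \<oplus> M(q)\<rangle>|a\<rangle>\<close>, which is an involution: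
  the new amplitude of \<open>(q, b, a)\<close> is the old amplitude of its preimage \<open>(q, b \<oplus> M(q), a)\<close>.
\<close>

definition qoracle :: "bit mat \<Rightarrow> qstate \<Rightarrow> qstate" where
  "qoracle M \<psi> = (\<lambda>(q, b, a). \<psi> (q, b + M $$ q, a))"

definition qinit :: qstate where
  "qinit x = (if x = ((0, 0), 0, 0) then 1 else 0)"

text \<open>\<open>qrun n w U M k\<close> is the state after \<open>k\<close> queries, \<open>U\<^sub>k O\<^sub>M U\<^sub>k\<^sub>-\<^sub>1 \<dots> U\<^sub>1 O\<^sub>M U\<^sub>0 |(0,0)\<rangle>|0\<rangle>|0\<rangle>\<close>.\<close>

fun qrun :: "nat \<Rightarrow> nat \<Rightarrow> (nat \<Rightarrow> qoperator) \<Rightarrow> bit mat \<Rightarrow> nat \<Rightarrow> qstate" where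
  "qrun n w U M 0 = qapply n w (U 0) qinit"
| "qrun n w U M (Suc k) = qapply n w (U (Suc k)) (qoracle M (qrun n w U M k))"

text \<open>
  The final state is measured in the computational basis and the outcome \<open>x\<close> is turned into the
  answer \<open>f x\<close>. As the last unitary and the workspace are arbitrary, this covers general measurements.
\<close>

definition qprob :: "nat \<Rightarrow> nat \<Rightarrow> qstate \<Rightarrow> (qbasis \<Rightarrow> bit mat) \<Rightarrow> bit mat \<Rightarrow> real" where
  "qprob n w \<psi> f A = (\<Sum>x\<in>{x\<in>qspace n w. f x = A}. (cmod (\<psi> x))\<^sup>2)"

definition Q_query :: "nat \<Rightarrow> bit mat set \<Rightarrow> nat" where
  "Q_query n X = (LEAST d. \<exists>w U f. w > 0 \<and> (\<forall>k\<le>d. qunitary n w (U k)) \<and>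
     (\<forall>M\<in>X. qprob n w (qrun n w U M d) f M \<ge> 2 / 3))"

end

theory Submission
  imports Defs
begin

text \<open>
  If a permutation is the only one avoiding a set \<open>Z\<close> of entries, then \<open>Z\<close> must block each of its row
  swaps, and an entry outside of the permutation blocks only one of them. So an adversary who answers 0
  whenever possible forces \<open>n choose 2\<close> queries, and searching row after row, with the last
  candidate of a row inferred, attains this number.

  Row swaps also give the other lower bounds. A decision tree that separates \<open>\<pi>\<close> from a row swap of it
  must query, on one of the two inputs, a 0 that is a 1 of the other, and every such query serves a single
  swap; averaging over all pairs gives the randomized bound. The quantum bound is the positive-weight adversary
  method for the same pairs.

  For the quantum upper bound each row is searched exactly with \<open>k = \<lceil>sqrt n\<rceil>\<close> queries. Unitaries leading through a
  prescribed sequence of states exist if the Gram matrices match, so that only states need to be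
  given, not circuits.
\<close>

section \<open>Permutation matrices given by a single permutation\<close>

definition perm_mat :: "nat \<Rightarrow> (nat \<Rightarrow> nat) \<Rightarrow> bit mat" where
  "perm_mat n \<pi> = Matrix.mat n n (\<lambda>(i, j). if \<pi> i = j then 1 else 0)"

lemma perm_mat_entry [simp]:
  "i < n \<Longrightarrow> j < n \<Longrightarrow> perm_mat n \<pi> $$ (i, j) = (if \<pi> i = j then 1 else 0)"
  by (simp add: perm_mat_def)

lemma permutes_less [simp]: "\<pi> permutes {..<n} \<Longrightarrow> \<pi> i < n \<longleftrightarrow> i < n"
  using permutes_in_image[of \<pi> "{..<n}" i] by simp

lemma perm_mat_eq_iff:
  assumes "\<pi> permutes {..<n}" "\<rho> permutes {..<n}"
  shows "perm_mat n \<pi> = perm_mat n \<rho> \<longleftrightarrow> \<pi> = \<rho>"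
proof
  assume eq: "perm_mat n \<pi> = perm_mat n \<rho>"
  show "\<pi> = \<rho>"
  proof
    fix i
    show "\<pi> i = \<rho> i"
    proof (cases "i < n")
      case True
      then have "perm_mat n \<rho> $$ (i, \<pi> i) = 1"
        using assms by (simp flip: eq)
      then show ?thesis using True assms by (auto split: if_splits)
    next
      case False
      then show ?thesis using assms by (simp add: permutes_not_in)
    qed
  qed
qed simp

text \<open>Row i of the permuted identity has its 1 in the column j with \<sigma> j = \<pi> i, so
  the inverse of \<sigma> after \<pi> describes the matrix alone.\<close>

lemma perm_matrices_eq: "perm_matrices n = perm_mat n ` {\<pi>. \<pi> permutes {..<n}}"
proof -
  have 1: "Matrix.mat n n (\<lambda>(i, j). 1\<^sub>m n $$ (\<pi> i, \<sigma> j)) = perm_mat n (inv_into UNIV \<sigma> \<circ> \<pi>)"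
    if "\<pi> permutes {..<n}" "\<sigma> permutes {..<n}" for \<pi> \<sigma>
    unfolding perm_mat_def
    by (rule cong_mat) (use that in \<open>auto simp: permutes_inverses permutes_inv_eq\<close>)
  show ?thesis
  proof (intro equalityI subsetI)
    fix M assume "M \<in> perm_matrices n"
    then obtain \<pi> \<sigma> where *: "\<pi> permutes {..<n}" "\<sigma> permutes {..<n}"
      "M = perm_mat n (inv_into UNIV \<sigma> \<circ> \<pi>)"
      unfolding perm_matrices_def using 1 by blast
    then show "M \<in> perm_mat n ` {\<pi>. \<pi> permutes {..<n}}"
      using permutes_compose[OF *(1) permutes_inv[OF *(2)]] by blast
  next
    fix M assume "M \<in> perm_mat n ` {\<pi>. \<pi> permutes {..<n}}"
    then obtain \<pi> where \<pi>: "\<pi> permutes {..<n}" "M = perm_mat n \<pi>" by auto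
    then have "M = Matrix.mat n n (\<lambda>(i, j). 1\<^sub>m n $$ (\<pi> i, id j))"
      using 1[OF \<pi>(1) permutes_id] by simp
    then show "M \<in> perm_matrices n"
      unfolding perm_matrices_def using \<pi>(1) permutes_id[of "{..<n}"] by blast
  qed
qed

section \<open>Deterministic query complexity\<close>

text \<open>By uniqueness Z contains an entry (a, b) of every row swap of \<pi>. It lies in a
  swapped row, as the other rows agree with \<pi>, so the swapped pair can be read off as a and the
  preimage of b under \<pi>: Z has an image containing all pairs.\<close>

lemma unique_avoiding_perm_card:
  assumes \<pi>: "\<pi> permutes {..<n}" "\<forall>i<n. (i, \<pi> i) \<notin> Z" and Z: "finite Z"
    and uniq: "\<And>\<rho>. \<rho> permutes {..<n} \<Longrightarrow> \<forall>i<n. (i, \<rho> i) \<notin> Z \<Longrightarrow> \<rho> = \<pi>"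
  shows "n choose 2 \<le> card Z"
proof -
  have "{P. P \<subseteq> {..<n} \<and> card P = 2} \<subseteq> (\<lambda>(a, b). {a, inv_into UNIV \<pi> b}) ` Z"
  proof
    fix P assume "P \<in> {P. P \<subseteq> {..<n} \<and> card P = 2}"
    then obtain i j where ij: "P = {i, j}" "i \<noteq> j" "i < n" "j < n"
      by (auto simp: card_2_iff)
    let ?\<rho> = "\<pi> \<circ> Transposition.transpose i j"
    have \<rho>: "?\<rho> permutes {..<n}"
      using \<pi> ij by (intro permutes_compose permutes_swap_id) auto
    have "?\<rho> i \<noteq> \<pi> i" using ij permutes_inj[OF \<pi>(1)] by (auto dest: injD)
    then have "?\<rho> \<noteq> \<pi>" by metis
    then obtain k where k: "k < n" "(k, ?\<rho> k) \<in> Z" using uniq[OF \<rho>] by auto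
    show "P \<in> (\<lambda>(a, b). {a, inv_into UNIV \<pi> b}) ` Z"
    proof (cases "k = i \<or> k = j")
      case True
      then show ?thesis
      proof
        assume "k = i"
        then have "(i, \<pi> j) \<in> Z" using k by simp
        moreover have "P = (\<lambda>(a, b). {a, inv_into UNIV \<pi> b}) (i, \<pi> j)" using ij \<pi> by (simp add: permutes_inverses)
        ultimately show ?thesis by blast
      next
        assume "k = j"
        then have "(j, \<pi> i) \<in> Z" using k by simp
        moreover have "P = (\<lambda>(a, b). {a, inv_into UNIV \<pi> b}) (j, \<pi> i)" using ij \<pi> by (auto simp: permutes_inverses)
        ultimately show ?thesis by blast
      qed
    next
      case False
      then have "(k, \<pi> k) \<in> Z" using k by (simp add: Transposition.transpose_def)
      then show ?thesis using \<pi> k by simp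
    qed
  qed
  then have "card {P. P \<subseteq> {..<n} \<and> card P = 2} \<le> card ((\<lambda>(a, b). {a, inv_into UNIV \<pi> b}) ` Z)"
    using Z by (intro card_mono) auto
  also have "\<dots> \<le> card Z" using Z by (rule card_image_le)
  finally show ?thesis using n_subsets[of "{..<n}" 2] by simp
qed

text \<open>The adversary answers 0 unless no permutation would avoid all entries in \<open>Z\<close>, those answered 0 so far;
  a forced answer 1 excludes no permutation, so \<open>Z\<close> alone records what is known.\<close>

lemma dtree_adversary:
  assumes "finite Z"
    and "\<exists>\<pi>. \<pi> permutes {..<n} \<and> (\<forall>i<n. (i, \<pi> i) \<notin> Z)"
    and "dtree_on n t"
    and "\<And>\<pi>. \<pi> permutes {..<n} \<Longrightarrow> \<forall>i<n. (i, \<pi> i) \<notin> Z \<Longrightarrow>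
      dtree_out t (perm_mat n \<pi>) = perm_mat n \<pi> \<and> dtree_cost t (perm_mat n \<pi>) \<le> d"
  shows "n choose 2 \<le> card Z + d"
  using assms
proof (induction t arbitrary: Z d)
  case (Output A)
  then obtain \<pi> where \<pi>: "\<pi> permutes {..<n}" "\<forall>i<n. (i, \<pi> i) \<notin> Z" by auto
  have "n choose 2 \<le> card Z"
    using \<pi> Output.prems by (intro unique_avoiding_perm_card[OF \<pi>]) (metis dtree_out.simps(1) perm_mat_eq_iff)+
  then show ?case by simp
next
  case (Query q t\<^sub>0 t\<^sub>1)
  obtain i j where q: "q = (i, j)" "i < n" "j < n" using Query.prems by auto
  \<comment> \<open>Some permutation avoids Z and is charged for this query, so d is positive and
    the truncated subtraction is exact.\<close>
  have d: "d = Suc (d - 1)"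
    using Query.prems(2,4) by fastforce
  show ?case
  proof (cases "\<exists>\<pi>. \<pi> permutes {..<n} \<and> (\<forall>i<n. (i, \<pi> i) \<notin> insert q Z)")
    case True
    have "n choose 2 \<le> card (insert q Z) + (d - 1)"
    proof (rule Query.IH(1)[OF _ True])
      fix \<pi> assume \<pi>: "\<pi> permutes {..<n}" "\<forall>i<n. (i, \<pi> i) \<notin> insert q Z"
      then show "dtree_out t\<^sub>0 (perm_mat n \<pi>) = perm_mat n \<pi> \<and> dtree_cost t\<^sub>0 (perm_mat n \<pi>) \<le> d - 1"
        using Query.prems(4)[of \<pi>] q d by auto
    qed (use Query.prems in auto)
    also have "\<dots> \<le> card Z + d" using d Query.prems(1) card_insert_le_m1 by (simp add: card_insert_if)
    finally show ?thesis .
  next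
    case False
    have "n choose 2 \<le> card Z + (d - 1)"
    proof (rule Query.IH(2)[OF _ Query.prems(2)])
      fix \<pi> assume \<pi>: "\<pi> permutes {..<n}" "\<forall>i<n. (i, \<pi> i) \<notin> Z"
      \<comment> \<open>The answer 1 is forced: every permutation avoiding Z contains (i, j). The
        query leaves the set of possible inputs as it was.\<close>
      then have "\<pi> i = j" using False q by auto
      then show "dtree_out t\<^sub>1 (perm_mat n \<pi>) = perm_mat n \<pi> \<and> dtree_cost t\<^sub>1 (perm_mat n \<pi>) \<le> d - 1"
        using Query.prems(4)[OF \<pi>] q d by auto
    qed (use Query.prems in auto)
    then show ?thesis by simp
  qed
qed

section \<open>Row-by-row search by a decision tree\<close>

definition solves :: "nat \<Rightarrow> bit mat set \<Rightarrow> nat \<Rightarrow> dtree \<Rightarrow> bool" where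
  "solves n X d t \<longleftrightarrow> dtree_on n t \<and> (\<forall>M\<in>X. dtree_out t M = M \<and> dtree_cost t M \<le> d)"

text \<open>The candidates in C are queried one after another, and the last one is inferred without
  a query. A search ending earlier only costs less.\<close>

lemma row_search:
  assumes "finite C" "C \<noteq> {}" "C \<subseteq> {..<n}" "i < n"
    and "\<And>\<pi>. \<pi> \<in> P \<Longrightarrow> \<pi> i \<in> C"
    and "\<And>c. c \<in> C \<Longrightarrow> \<exists>t. solves n (perm_mat n ` {\<pi> \<in> P. \<pi> i = c}) d t"
  shows "\<exists>t. solves n (perm_mat n ` P) (d + (card C - 1)) t"
  using assms
proof (induction C arbitrary: P rule: finite_ne_induct)
  case (singleton c)
  then have "{\<pi> \<in> P. \<pi> i = c} = P" by auto
  then show ?case using singleton by auto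
next
  case (insert c C)
  have "\<exists>t. solves n (perm_mat n ` {\<pi> \<in> P. \<pi> i \<noteq> c}) (d + (card C - 1)) t"
  proof (rule insert.IH)
    fix c' assume "c' \<in> C"
    then have "{\<pi> \<in> {\<pi> \<in> P. \<pi> i \<noteq> c}. \<pi> i = c'} = {\<pi> \<in> P. \<pi> i = c'}"
      using insert.hyps by auto
    then show "\<exists>t. solves n (perm_mat n ` {\<pi> \<in> {\<pi> \<in> P. \<pi> i \<noteq> c}. \<pi> i = c'}) d t"
      using insert.prems \<open>c' \<in> C\<close> by simp
  qed (use insert.prems in auto)
  then obtain t\<^sub>0 where t\<^sub>0: "solves n (perm_mat n ` {\<pi> \<in> P. \<pi> i \<noteq> c}) (d + (card C - 1)) t\<^sub>0" ..
  obtain t\<^sub>1 where t\<^sub>1: "solves n (perm_mat n ` {\<pi> \<in> P. \<pi> i = c}) d t\<^sub>1"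
    using insert.prems by blast
  have "card C > 0" using insert.hyps by (simp add: card_gt_0_iff)
  then have "solves n (perm_mat n ` P) (d + (card (insert c C) - 1)) (Query (i, c) t\<^sub>0 t\<^sub>1)"
    using t\<^sub>0 t\<^sub>1 insert.prems insert.hyps unfolding solves_def by (force simp: card_insert_if)
  then show ?case ..
qed

text \<open>The hypotheses are the invariant of the search: rows outside of I are known, and those
  in I are matched with the remaining columns C. In the induction step row i has
  \<open>card I + 1\<close> candidates, so \<open>card I\<close> queries find it, and Pascal's rule
  adds up the costs.\<close>

lemma rows_search:
  assumes "finite I" "I \<subseteq> {..<n}"
    and "\<And>\<pi>. \<pi> \<in> P \<Longrightarrow> \<pi> permutes {..<n}"
    and "\<And>\<pi>. \<pi> \<in> P \<Longrightarrow> \<pi> ` I = C"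
    and "\<And>\<pi> \<rho> i. \<pi> \<in> P \<Longrightarrow> \<rho> \<in> P \<Longrightarrow> i \<notin> I \<Longrightarrow> \<pi> i = \<rho> i"
  shows "\<exists>t. solves n (perm_mat n ` P) (card I choose 2) t"
  using assms
proof (induction I arbitrary: P C rule: finite_induct)
  case empty
  show ?case
  proof (cases "P = {}")
    case True
    then show ?thesis by (auto simp: solves_def intro: exI[of _ "Output undefined"])
  next
    case False
    then obtain \<pi> where "\<pi> \<in> P" by auto
    then have "P = {\<pi>}" using empty.prems(4) by blast
    then show ?thesis by (auto simp: solves_def intro: exI[of _ "Output (perm_mat n \<pi>)"])
  qed
next
  case (insert i I)
  show ?case
  proof (cases "P = {}")
    case True
    then show ?thesis by (auto simp: solves_def intro: exI[of _ "Output undefined"])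
  next
    case False
    then obtain \<rho> where \<rho>: "\<rho> \<in> P" by auto
    have inj: "inj \<pi>" if "\<pi> \<in> P" for \<pi> using insert.prems(2)[OF that] by (rule permutes_inj)
    have C: "C = \<rho> ` insert i I" using insert.prems(3) \<rho> by auto
    have cardC: "card C = Suc (card I)"
      unfolding C using insert.hyps card_image[OF inj_on_subset[OF inj[OF \<rho>] subset_UNIV, of "insert i I"]] by simp
    have "\<exists>t. solves n (perm_mat n ` P) ((card I choose 2) + (card C - 1)) t"
    proof (rule row_search)
      show "finite C" "C \<noteq> {}" using C insert.hyps by auto
      show "C \<subseteq> {..<n}" using C insert.prems(1) insert.prems(2)[OF \<rho>] by auto
      show "i < n" using insert.prems by auto
      show "\<pi> i \<in> C" if "\<pi> \<in> P" for \<pi> using insert.prems(3)[OF that] by auto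
      show "\<exists>t. solves n (perm_mat n ` {\<pi> \<in> P. \<pi> i = c}) (card I choose 2) t" if "c \<in> C" for c
      proof (rule insert.IH)
        fix \<pi> assume \<pi>: "\<pi> \<in> {\<pi> \<in> P. \<pi> i = c}"
        have "\<pi> i \<notin> \<pi> ` I" using \<pi> inj[of \<pi>] insert.hyps by (auto dest: injD)
        then show "\<pi> ` I = C - {c}" using insert.prems(3)[of \<pi>] \<pi> by blast
      next
        fix \<pi> \<rho> j assume "\<pi> \<in> {\<pi> \<in> P. \<pi> i = c}" "\<rho> \<in> {\<pi> \<in> P. \<pi> i = c}" "j \<notin> I"
        then show "\<pi> j = \<rho> j" using insert.prems(4)[of \<pi> \<rho> j] by (cases "j = i") auto
      qed (use insert.prems in auto)
    qed
    moreover have "(card I choose 2) + (card C - 1) = card (insert i I) choose 2"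
      using insert.hyps cardC by (simp add: numeral_2_eq_2)
    ultimately show ?thesis by simp
  qed
qed

lemma perm_matrices_solvable: "\<exists>t. solves n (perm_matrices n) (n choose 2) t"
  unfolding perm_matrices_eq
  using rows_search[of "{..<n}" n "{\<pi>. \<pi> permutes {..<n}}" "{..<n}"]
  by (simp add: permutes_image permutes_not_in)

lemma D_query_perm_matrices: "D_query n (perm_matrices n) = n choose 2"
  unfolding D_query_def
proof (rule Least_equality)
  show "\<exists>t. dtree_on n t \<and> (\<forall>M\<in>perm_matrices n. dtree_out t M = M \<and> dtree_cost t M \<le> n choose 2)"
    using perm_matrices_solvable by (simp add: solves_def)
next
  fix d assume "\<exists>t. dtree_on n t \<and> (\<forall>M\<in>perm_matrices n. dtree_out t M = M \<and> dtree_cost t M \<le> d)"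
  then obtain t where t: "dtree_on n t"
    "\<And>M. M \<in> perm_matrices n \<Longrightarrow> dtree_out t M = M \<and> dtree_cost t M \<le> d" by auto
  have "n choose 2 \<le> card ({} :: (nat \<times> nat) set) + d"
  proof (rule dtree_adversary[OF _ _ t(1)])
    show "\<exists>\<pi>. \<pi> permutes {..<n} \<and> (\<forall>i<n. (i, \<pi> i) \<notin> {})"
      using permutes_id[of "{..<n}"] by blast
    show "dtree_out t (perm_mat n \<pi>) = perm_mat n \<pi> \<and> dtree_cost t (perm_mat n \<pi>) \<le> d"
      if "\<pi> permutes {..<n}" for \<pi> using that t(2) by (simp add: perm_matrices_eq)
  qed simp
  then show "n choose 2 \<le> d" by simp
qed

section \<open>Randomized query complexity\<close>

definition row_pairs :: "nat \<Rightarrow> (nat \<times> nat) set" where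
  "row_pairs n = {(i, j). i < j \<and> j < n}"

definition swap_rows :: "(nat \<Rightarrow> nat) \<Rightarrow> nat \<times> nat \<Rightarrow> nat \<Rightarrow> nat" where
  "swap_rows \<pi> e = \<pi> \<circ> Transposition.transpose (fst e) (snd e)"

lemma finite_row_pairs [simp]: "finite (row_pairs n)"
  by (rule finite_subset[of _ "{..<n} \<times> {..<n}"]) (auto simp: row_pairs_def)

lemma card_row_pairs: "card (row_pairs n) = n choose 2"
proof -
  have "bij_betw (\<lambda>(i, j). {i, j}) (row_pairs n) {P. P \<subseteq> {..<n} \<and> card P = 2}"
  proof (rule bij_betw_imageI)
    show "inj_on (\<lambda>(i, j). {i, j}) (row_pairs n)"
      by (auto simp: inj_on_def row_pairs_def doubleton_eq_iff)
    show "(\<lambda>(i, j). {i, j}) ` row_pairs n = {P. P \<subseteq> {..<n} \<and> card P = 2}"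
    proof
      show "{P. P \<subseteq> {..<n} \<and> card P = 2} \<subseteq> (\<lambda>(i, j). {i, j}) ` row_pairs n"
      proof
        fix P assume "P \<in> {P. P \<subseteq> {..<n} \<and> card P = 2}"
        then obtain i j where "P = {i, j}" "i < n" "j < n" "i < j"
          by (auto simp: card_2_iff) (metis insert_commute nat_neq_iff)
        then show "P \<in> (\<lambda>(i, j). {i, j}) ` row_pairs n"
          by (auto simp: row_pairs_def intro!: image_eqI[of _ _ "(i, j)"])
      qed
    qed (auto simp: row_pairs_def)
  qed
  then show ?thesis using n_subsets[of "{..<n}" 2] by (simp add: bij_betw_same_card)
qed

lemma swap_rows_permutes [simp]:
  "\<pi> permutes {..<n} \<Longrightarrow> e \<in> row_pairs n \<Longrightarrow> swap_rows \<pi> e permutes {..<n}"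
  unfolding swap_rows_def by (intro permutes_compose permutes_swap_id) (auto simp: row_pairs_def)

lemma swap_rows_involutory [simp]: "swap_rows (swap_rows \<pi> e) e = \<pi>"
  by (simp add: swap_rows_def comp_assoc)

lemma swap_rows_neq:
  assumes "\<pi> permutes {..<n}" "e \<in> row_pairs n"
  shows "swap_rows \<pi> e \<noteq> \<pi>"
proof
  assume "swap_rows \<pi> e = \<pi>"
  then have "swap_rows \<pi> e (fst e) = \<pi> (fst e)" by simp
  then have "\<pi> (snd e) = \<pi> (fst e)" by (simp add: swap_rows_def)
  then have "snd e = fst e" using permutes_inj[OF assms(1)] by (auto dest: injD)
  then show False using assms(2) by (auto simp: row_pairs_def)
qed

text \<open>A swap is its own inverse, so this is a reindexing. It lets the two ends of a swap
  exchange roles in the double sums below.\<close>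

lemma sum_swap_rows:
  assumes "e \<in> row_pairs n"
  shows "(\<Sum>\<pi> | \<pi> permutes {..<n}. f (swap_rows \<pi> e)) = (\<Sum>\<pi> | \<pi> permutes {..<n}. f \<pi>)"
  by (rule sum.reindex_bij_witness[of _ "\<lambda>\<pi>. swap_rows \<pi> e" "\<lambda>\<pi>. swap_rows \<pi> e"]) (use assms in auto)

text \<open>Only the swap of row a with the row c such that \<pi> c = b moves a 1 to (a, b).\<close>

lemma card_swap_rows_hitting_zero:
  assumes "\<pi> permutes {..<n}" "\<pi> a \<noteq> b"
  shows "card {e \<in> row_pairs n. swap_rows \<pi> e a = b} \<le> 1"
proof -
  define c where "c = inv_into UNIV \<pi> b"
  have c: "\<pi> x = b \<longleftrightarrow> x = c" for x
    using permutes_inverses[OF assms(1)] by (auto simp: c_def)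
  have "{e \<in> row_pairs n. swap_rows \<pi> e a = b} \<subseteq> {(min a c, max a c)}"
    using assms by (auto simp: swap_rows_def c row_pairs_def Transposition.transpose_def split: if_splits)
  from card_mono[OF _ this] show ?thesis by simp
qed

text \<open>Row a changes only when swapped with one of the n - 1 other rows.\<close>

lemma card_swap_rows_moving:
  assumes "\<pi> permutes {..<n}" "a < n"
  shows "card {e \<in> row_pairs n. swap_rows \<pi> e a \<noteq> \<pi> a} \<le> n - 1"
proof -
  have "{e \<in> row_pairs n. swap_rows \<pi> e a \<noteq> \<pi> a} \<subseteq> (\<lambda>j. (min a j, max a j)) ` ({..<n} - {a})"
  proof
    fix e assume e: "e \<in> {e \<in> row_pairs n. swap_rows \<pi> e a \<noteq> \<pi> a}"
    then have "a = fst e \<or> a = snd e"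
      by (auto simp: swap_rows_def Transposition.transpose_def split: if_splits)
    then show "e \<in> (\<lambda>j. (min a j, max a j)) ` ({..<n} - {a})"
    proof
      assume "a = fst e"
      then show ?thesis using e by (intro image_eqI[of _ _ "snd e"]) (auto simp: row_pairs_def)
    next
      assume "a = snd e"
      then show ?thesis using e by (intro image_eqI[of _ _ "fst e"]) (auto simp: row_pairs_def)
    qed
  qed
  then have "card {e \<in> row_pairs n. swap_rows \<pi> e a \<noteq> \<pi> a} \<le> card ((\<lambda>j. (min a j, max a j)) ` ({..<n} - {a}))"
    by (intro card_mono) auto
  also have "\<dots> \<le> card ({..<n} - {a})" by (intro card_image_le) auto
  finally show ?thesis using assms by simp
qed

section \<open>Separation of neighbours by queries answered 0\<close>

text \<open>Queries answered 1 are left out: one of them may serve n - 1 swaps, a query answered 0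
  at most one.\<close>

fun zero_queries :: "dtree \<Rightarrow> bit mat \<Rightarrow> (nat \<times> nat) set" where
  "zero_queries (Output A) M = {}"
| "zero_queries (Query q t\<^sub>0 t\<^sub>1) M =
    (if M $$ q = 0 then insert q (zero_queries t\<^sub>0 M) else zero_queries t\<^sub>1 M)"

lemma finite_zero_queries [simp]: "finite (zero_queries t M)"
  by (induction t) auto

lemma card_zero_queries: "card (zero_queries t M) \<le> dtree_cost t M"
  by (induction t) (auto simp: card_insert_if)

lemma zero_queries_range: "dtree_on n t \<Longrightarrow> zero_queries t M \<subseteq> {..<n} \<times> {..<n}"
  by (induction t) auto

lemma zero_queries_zero: "q \<in> zero_queries t M \<Longrightarrow> M $$ q = 0"
  by (induction t) (auto split: if_splits)

text \<open>At the first query with different answers one of the answers is 0, and on that input the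
  query belongs to \<open>zero_queries\<close>.\<close>

lemma separated_by_zero_query:
  assumes "dtree_out t M \<noteq> dtree_out t M'"
  shows "(\<exists>q\<in>zero_queries t M. M' $$ q \<noteq> 0) \<or> (\<exists>q\<in>zero_queries t M'. M $$ q \<noteq> 0)"
  using assms by (induction t) (auto split: if_splits)

lemma card_separated_at_zero:
  assumes "dtree_on n t" "\<pi> permutes {..<n}"
  shows "card {e \<in> row_pairs n. \<exists>q\<in>zero_queries t (perm_mat n \<pi>). perm_mat n (swap_rows \<pi> e) $$ q \<noteq> 0}
    \<le> dtree_cost t (perm_mat n \<pi>)"
proof -
  let ?Z = "zero_queries t (perm_mat n \<pi>)"
  have "card {e \<in> row_pairs n. \<exists>q\<in>?Z. perm_mat n (swap_rows \<pi> e) $$ q \<noteq> 0}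
    \<le> card (\<Union>q\<in>?Z. {e \<in> row_pairs n. perm_mat n (swap_rows \<pi> e) $$ q \<noteq> 0})"
    by (intro card_mono) auto
  also have "\<dots> \<le> (\<Sum>q\<in>?Z. card {e \<in> row_pairs n. perm_mat n (swap_rows \<pi> e) $$ q \<noteq> 0})"
    by (rule card_UN_le) simp
  also have "\<dots> \<le> (\<Sum>q\<in>?Z. 1)"
  proof (rule sum_mono)
    fix q assume q: "q \<in> ?Z"
    then obtain a b where ab: "q = (a, b)" "a < n" "b < n" using zero_queries_range[OF assms(1)] by blast
    have "\<pi> a \<noteq> b" using zero_queries_zero[OF q] ab by (auto split: if_splits)
    moreover have "{e \<in> row_pairs n. perm_mat n (swap_rows \<pi> e) $$ q \<noteq> 0} = {e \<in> row_pairs n. swap_rows \<pi> e a = b}"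
      using ab by auto
    ultimately show "card {e \<in> row_pairs n. perm_mat n (swap_rows \<pi> e) $$ q \<noteq> 0} \<le> 1"
      using card_swap_rows_hitting_zero[OF assms(2)] by simp
  qed
  also have "\<dots> \<le> dtree_cost t (perm_mat n \<pi>)" using card_zero_queries by simp
  finally show ?thesis .
qed

text \<open>A tree that is correct at both ends of a swap separates them, so at one end it queries a
  0 that is a 1 at the other. Each permutation is charged for at most d swaps in this way; the
  factor 2 counts the two ends.\<close>

lemma card_correct_pairs:
  assumes t: "dtree_on n t" and d: "\<And>\<pi>. \<pi> permutes {..<n} \<Longrightarrow> dtree_cost t (perm_mat n \<pi>) \<le> d"
  defines "ok \<equiv> \<lambda>\<pi>. dtree_out t (perm_mat n \<pi>) = perm_mat n \<pi>"
  shows "(\<Sum>\<pi> | \<pi> permutes {..<n}. \<Sum>e\<in>row_pairs n. of_bool (ok \<pi> \<and> ok (swap_rows \<pi> e)) :: nat)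
    \<le> 2 * d * card {\<pi>. \<pi> permutes {..<n}}"
proof -
  define sep where "sep \<pi> e \<longleftrightarrow>
    (\<exists>q\<in>zero_queries t (perm_mat n \<pi>). perm_mat n (swap_rows \<pi> e) $$ q \<noteq> 0)" for \<pi> e
  have half: "(\<Sum>\<pi> | \<pi> permutes {..<n}. \<Sum>e\<in>row_pairs n. of_bool (sep \<pi> e) :: nat) \<le> d * card {\<pi>. \<pi> permutes {..<n}}"
  proof -
    have "(\<Sum>e\<in>row_pairs n. of_bool (sep \<pi> e) :: nat) \<le> d" if "\<pi> permutes {..<n}" for \<pi>
    proof -
      have "(\<Sum>e\<in>row_pairs n. of_bool (sep \<pi> e) :: nat) = card {e \<in> row_pairs n. sep \<pi> e}"
        by (simp add: sum.If_cases of_bool_def Int_def)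
      also have "\<dots> \<le> d" unfolding sep_def
        using card_separated_at_zero[OF t that] d[OF that] by linarith
      finally show ?thesis .
    qed
    then have "(\<Sum>\<pi> | \<pi> permutes {..<n}. \<Sum>e\<in>row_pairs n. of_bool (sep \<pi> e) :: nat) \<le> (\<Sum>\<pi> | \<pi> permutes {..<n}. d)"
      by (intro sum_mono) auto
    then show ?thesis by (simp add: mult.commute)
  qed
  have "(\<Sum>\<pi> | \<pi> permutes {..<n}. \<Sum>e\<in>row_pairs n. of_bool (ok \<pi> \<and> ok (swap_rows \<pi> e)) :: nat)
    \<le> (\<Sum>\<pi> | \<pi> permutes {..<n}. \<Sum>e\<in>row_pairs n. of_bool (sep \<pi> e) + of_bool (sep (swap_rows \<pi> e) e))"
  proof (intro sum_mono)
    fix \<pi> e assume *: "\<pi> \<in> {\<pi>. \<pi> permutes {..<n}}" "e \<in> row_pairs n"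
    have "sep \<pi> e \<or> sep (swap_rows \<pi> e) e" if "ok \<pi>" "ok (swap_rows \<pi> e)"
    proof -
      have "perm_mat n \<pi> \<noteq> perm_mat n (swap_rows \<pi> e)"
        using * swap_rows_neq[of \<pi> n e] by (subst perm_mat_eq_iff) auto
      then show ?thesis
        using separated_by_zero_query[of t "perm_mat n \<pi>" "perm_mat n (swap_rows \<pi> e)"] that
        by (auto simp: ok_def sep_def)
    qed
    then show "(of_bool (ok \<pi> \<and> ok (swap_rows \<pi> e)) :: nat) \<le> of_bool (sep \<pi> e) + of_bool (sep (swap_rows \<pi> e) e)"
      by auto
  qed
  also have "\<dots> = (\<Sum>\<pi> | \<pi> permutes {..<n}. \<Sum>e\<in>row_pairs n. of_bool (sep \<pi> e)) +
      (\<Sum>\<pi> | \<pi> permutes {..<n}. \<Sum>e\<in>row_pairs n. of_bool (sep (swap_rows \<pi> e) e))"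
    by (simp add: sum.distrib)
  \<comment> \<open>For fixed e the swap permutes the inputs, so both ends contribute the same
    sum.\<close>
  also have "(\<Sum>\<pi> | \<pi> permutes {..<n}. \<Sum>e\<in>row_pairs n. of_bool (sep (swap_rows \<pi> e) e) :: nat) =
      (\<Sum>e\<in>row_pairs n. \<Sum>\<pi> | \<pi> permutes {..<n}. of_bool (sep (swap_rows \<pi> e) e))"
    by (rule sum.swap)
  also have "\<dots> = (\<Sum>e\<in>row_pairs n. \<Sum>\<pi> | \<pi> permutes {..<n}. of_bool (sep \<pi> e))"
    by (rule sum.cong[OF refl], rule sum_swap_rows)
  also have "\<dots> = (\<Sum>\<pi> | \<pi> permutes {..<n}. \<Sum>e\<in>row_pairs n. of_bool (sep \<pi> e))"
    by (rule sum.swap)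
  finally show ?thesis using half by linarith
qed

text \<open>Inclusion-exclusion: 2/3 + 2/3 - 1 = 1/3.\<close>

lemma prob_both:
  assumes "measure_pmf.prob p A \<ge> 2 / 3" "measure_pmf.prob p B \<ge> 2 / 3"
  shows "measure_pmf.prob p (A \<inter> B) \<ge> 1 / 3"
proof -
  have "measure_pmf.prob p A + measure_pmf.prob p B = measure_pmf.prob p (A \<union> B) + measure_pmf.prob p (A \<inter> B)"
    by (subst measure_pmf.finite_measure_Union') (simp_all add: measure_pmf.finite_measure_Diff' Int_commute)
  then show ?thesis using assms measure_pmf.prob_le_1[of p "A \<union> B"] by linarith
qed

text \<open>For each swap both ends are answered correctly with probability at least 1/3, while a
  tree in the support is correct at both ends of at most 2 d swaps per permutation on average.
  Comparing expectations gives (n choose 2) / 3 \<le> 2 d.\<close>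

lemma randomized_lower_bound:
  fixes p :: "dtree pmf"
  assumes p: "\<And>t \<pi>. t \<in> set_pmf p \<Longrightarrow> \<pi> permutes {..<n} \<Longrightarrow> dtree_cost t (perm_mat n \<pi>) \<le> d"
    "\<And>t. t \<in> set_pmf p \<Longrightarrow> dtree_on n t"
    and succ: "\<And>\<pi>. \<pi> permutes {..<n} \<Longrightarrow>
      measure_pmf.prob p {t. dtree_out t (perm_mat n \<pi>) = perm_mat n \<pi>} \<ge> 2 / 3"
  shows "n choose 2 \<le> 6 * d"
proof -
  define S where "S = {\<pi>. \<pi> permutes {..<n}}"
  define G where "G \<pi> = {t. dtree_out t (perm_mat n \<pi>) = perm_mat n \<pi>}" for \<pi>
  have fin: "finite S" by (simp add: S_def finite_permutations)
  have ne: "S \<noteq> {}" using permutes_id[of "{..<n}"] unfolding S_def by blast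
  have int: "integrable (measure_pmf p) (indicator A :: dtree \<Rightarrow> real)" for A
    by (auto intro: measure_pmf.integrable_const_bound[where B = 1])
  have "real (card S * (n choose 2)) / 3 = (\<Sum>\<pi>\<in>S. \<Sum>e\<in>row_pairs n. 1 / 3)"
    by (simp add: card_row_pairs)
  also have "\<dots> \<le> (\<Sum>\<pi>\<in>S. \<Sum>e\<in>row_pairs n. measure_pmf.prob p (G \<pi> \<inter> G (swap_rows \<pi> e)))"
    unfolding S_def G_def by (intro sum_mono prob_both succ) auto
  also have "\<dots> = (\<Sum>\<pi>\<in>S. \<Sum>e\<in>row_pairs n. measure_pmf.expectation p (indicator (G \<pi> \<inter> G (swap_rows \<pi> e))))"
    by simp
  also have "\<dots> = measure_pmf.expectation p (\<lambda>t. \<Sum>\<pi>\<in>S. \<Sum>e\<in>row_pairs n. indicator (G \<pi> \<inter> G (swap_rows \<pi> e)) t)"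
    using int by (simp only: Bochner_Integration.integral_sum Bochner_Integration.integrable_sum)
  also have "\<dots> \<le> measure_pmf.expectation p (\<lambda>t. real (2 * d * card S))"
  proof (rule integral_mono_AE)
    show "AE t in measure_pmf p. (\<Sum>\<pi>\<in>S. \<Sum>e\<in>row_pairs n. indicator (G \<pi> \<inter> G (swap_rows \<pi> e)) t) \<le> real (2 * d * card S)"
    proof (subst AE_measure_pmf_iff, intro ballI)
      fix t assume t: "t \<in> set_pmf p"
      have "(\<Sum>\<pi>\<in>S. \<Sum>e\<in>row_pairs n. indicator (G \<pi> \<inter> G (swap_rows \<pi> e)) t) =
        real (\<Sum>\<pi>\<in>S. \<Sum>e\<in>row_pairs n. of_bool (t \<in> G \<pi> \<and> t \<in> G (swap_rows \<pi> e)))"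
        by (simp add: indicator_def)
      also have "\<dots> \<le> real (2 * d * card S)"
        unfolding of_nat_le_iff S_def G_def mem_Collect_eq
        by (rule card_correct_pairs) (use p t in auto)
      finally show "(\<Sum>\<pi>\<in>S. \<Sum>e\<in>row_pairs n. indicator (G \<pi> \<inter> G (swap_rows \<pi> e)) t) \<le> real (2 * d * card S)" .
    qed
  qed (auto intro!: Bochner_Integration.integrable_sum int)
  also have "\<dots> = real (2 * d * card S)" by simp
  finally have "real ((n choose 2) * card S) \<le> real (6 * d * card S)" by (simp add: mult_ac)
  then have "(n choose 2) * card S \<le> 6 * d * card S" by (simp only: of_nat_le_iff)
  then show ?thesis using fin ne by (simp add: card_gt_0_iff)
qed

lemma R_query_perm_matrices_le: "R_query n (perm_matrices n) \<le> n choose 2"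
proof -
  obtain t where t: "solves n (perm_matrices n) (n choose 2) t"
    using perm_matrices_solvable by auto
  show ?thesis
    unfolding R_query_def
    by (rule Least_le, rule exI[of _ "return_pmf t"]) (use t in \<open>auto simp: solves_def indicator_def\<close>)
qed

lemma R_query_perm_matrices_ge: "n choose 2 \<le> 6 * R_query n (perm_matrices n)"
proof -
  let ?P = "\<lambda>d. \<exists>p :: dtree pmf.
     (\<forall>t\<in>set_pmf p. dtree_on n t \<and> (\<forall>M\<in>perm_matrices n. dtree_cost t M \<le> d)) \<and>
     (\<forall>M\<in>perm_matrices n. measure_pmf.prob p {t. dtree_out t M = M} \<ge> 2 / 3)"
  obtain t where t: "solves n (perm_matrices n) (n choose 2) t"
    using perm_matrices_solvable by auto
  have "?P (n choose 2)"
    by (rule exI[of _ "return_pmf t"]) (use t in \<open>auto simp: solves_def indicator_def\<close>)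
  then have "?P (R_query n (perm_matrices n))"
    unfolding R_query_def by (rule LeastI)
  then obtain p :: "dtree pmf" where
    "\<forall>t\<in>set_pmf p. dtree_on n t \<and> (\<forall>M\<in>perm_matrices n. dtree_cost t M \<le> R_query n (perm_matrices n))"
    "\<forall>M\<in>perm_matrices n. measure_pmf.prob p {t. dtree_out t M = M} \<ge> 2 / 3" by blast
  then show ?thesis
    by (intro randomized_lower_bound[of p]) (auto simp: perm_matrices_eq)
qed

section \<open>Quantum lower bound\<close>

text \<open>The positive-weight adversary method: the sum of the inner products of the states on neighbouring
  permutations is maximal before the first query, must be bounded away from its maximum at the end,
  and changes by little in each query.\<close>

definition qinner :: "nat \<Rightarrow> nat \<Rightarrow> qstate \<Rightarrow> qstate \<Rightarrow> complex" where
  "qinner n w \<psi> \<phi> = (\<Sum>x\<in>qspace n w. cnj (\<psi> x) * \<phi> x)"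

text \<open>For a unit vector, the probability that q is found in the query register.\<close>

definition qweight :: "nat \<Rightarrow> qstate \<Rightarrow> nat \<times> nat \<Rightarrow> real" where
  "qweight w \<psi> q = (\<Sum>x\<in>UNIV \<times> {..<w}. (cmod (\<psi> (q, x)))\<^sup>2)"

text \<open>The contribution of query register q to the real part of the inner product. The oracle
  acts within each such block separately.\<close>

definition qblock :: "nat \<Rightarrow> qstate \<Rightarrow> qstate \<Rightarrow> nat \<times> nat \<Rightarrow> real" where
  "qblock w \<psi> \<phi> q = (\<Sum>x\<in>UNIV \<times> {..<w}. Re (cnj (\<psi> (q, x)) * \<phi> (q, x)))"

lemma bit_UNIV: "(UNIV :: bit set) = {0, 1}"
  using bit_not_one_iff by auto

lemma finite_qspace [simp]: "finite (qspace n w)"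
  by (simp add: qspace_def bit_UNIV)

lemma Re_qinner_blocks: "Re (qinner n w \<psi> \<phi>) = (\<Sum>q\<in>{..<n} \<times> {..<n}. qblock w \<psi> \<phi> q)"
  unfolding qinner_def qspace_def qblock_def by (simp add: sum.cartesian_product' del: complex_cnj_mult)

lemma Re_qinner_self: "Re (qinner n w \<psi> \<psi>) = (\<Sum>x\<in>qspace n w. (cmod (\<psi> x))\<^sup>2)"
  by (simp add: qinner_def cmod_power2) (simp add: power2_eq_square)

lemma sum_qweight: "(\<Sum>q\<in>{..<n} \<times> {..<n}. qweight w \<psi> q) = Re (qinner n w \<psi> \<psi>)"
  unfolding Re_qinner_self qspace_def qweight_def by (simp add: sum.cartesian_product')

lemma qinner_qapply:
  assumes "qunitary n w U"
  shows "qinner n w (qapply n w U \<psi>) (qapply n w U \<phi>) = qinner n w \<psi> \<phi>"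
proof -
  let ?S = "qspace n w"
  have "qinner n w (qapply n w U \<psi>) (qapply n w U \<phi>) =
    (\<Sum>x\<in>?S. \<Sum>y\<in>?S. \<Sum>z\<in>?S. cnj (\<psi> y) * \<phi> z * (cnj (U x y) * U x z))"
    unfolding qinner_def qapply_def cnj_sum sum_product by (simp add: mult_ac)
  also have "\<dots> = (\<Sum>y\<in>?S. \<Sum>x\<in>?S. \<Sum>z\<in>?S. cnj (\<psi> y) * \<phi> z * (cnj (U x y) * U x z))"
    by (rule sum.swap)
  also have "\<dots> = (\<Sum>y\<in>?S. \<Sum>z\<in>?S. \<Sum>x\<in>?S. cnj (\<psi> y) * \<phi> z * (cnj (U x y) * U x z))"
    by (intro sum.cong[OF refl] sum.swap)
  also have "\<dots> = (\<Sum>y\<in>?S. \<Sum>z\<in>?S. cnj (\<psi> y) * \<phi> z * (if y = z then 1 else 0))"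
    using assms unfolding qunitary_def by (simp flip: sum_distrib_left)
  also have "\<dots> = qinner n w \<psi> \<phi>"
    by (simp add: qinner_def if_distrib sum.delta cong: if_cong)
  finally show ?thesis .
qed

lemma sum_bit_shift:
  "(\<Sum>x\<in>UNIV \<times> {..<w}. g (fst x + c, snd x)) = (\<Sum>x\<in>(UNIV :: bit set) \<times> {..<w}. g x)"
  by (rule sum.reindex_bij_witness[of _ "\<lambda>x. (fst x + c, snd x)" "\<lambda>x. (fst x + c, snd x)"])
    (auto simp: add.assoc)

text \<open>Equal answers shift both states by the same bit, which only permutes the terms of the
  block.\<close>

lemma qblock_qoracle_eq:
  assumes "M $$ q = M' $$ q"
  shows "qblock w (qoracle M \<psi>) (qoracle M' \<phi>) q = qblock w \<psi> \<phi> q"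
  using sum_bit_shift[of "\<lambda>x. Re (cnj (\<psi> (q, x)) * \<phi> (q, x))" "M $$ q" w] assms
  by (simp add: qblock_def qoracle_def case_prod_beta)

lemma qweight_qoracle [simp]: "qweight w (qoracle M \<psi>) = qweight w \<psi>"
proof
  fix q show "qweight w (qoracle M \<psi>) q = qweight w \<psi> q"
    using sum_bit_shift[of "\<lambda>x. (cmod (\<psi> (q, x)))\<^sup>2" "M $$ q" w]
    by (simp add: qweight_def qoracle_def case_prod_beta)
qed

text \<open>The square of h a - b, divided by h, is nonnegative. The free parameter h allows the two
  sides to be weighted differently.\<close>

lemma two_mult_le_weighted_squares:
  fixes a b h :: real
  assumes "h > 0"
  shows "2 * (a * b) \<le> h * a\<^sup>2 + b\<^sup>2 / h"
proof -
  have "0 \<le> (h * a - b)\<^sup>2 / h" using assms by simp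
  also have "\<dots> = h * a\<^sup>2 + b\<^sup>2 / h - 2 * (a * b)"
    using assms by (simp add: field_simps power2_eq_square)
  finally show ?thesis by simp
qed

lemma two_Re_le_weighted_squares:
  assumes "h > 0"
  shows "2 * Re (cnj x * y) \<le> h * (cmod x)\<^sup>2 + (cmod y)\<^sup>2 / h"
proof -
  have "Re (cnj x * y) \<le> cmod (cnj x * y)" by (rule complex_Re_le_cmod)
  then have "2 * Re (cnj x * y) \<le> 2 * (cmod x * cmod y)" by (simp add: norm_mult)
  then show ?thesis using two_mult_le_weighted_squares[OF assms, of "cmod x" "cmod y"] by linarith
qed

lemma qblock_le:
  assumes "h > 0"
  shows "2 * qblock w \<psi> \<phi> q \<le> h * qweight w \<psi> q + qweight w \<phi> q / h"
proof -
  have "2 * qblock w \<psi> \<phi> q \<le> (\<Sum>x\<in>UNIV \<times> {..<w}. h * (cmod (\<psi> (q, x)))\<^sup>2 + (cmod (\<phi> (q, x)))\<^sup>2 / h)"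
    unfolding qblock_def sum_distrib_left by (intro sum_mono two_Re_le_weighted_squares assms)
  then show ?thesis
    by (simp add: qweight_def sum.distrib sum_distrib_left sum_divide_distrib)
qed

lemma qblock_uminus: "qblock w (\<lambda>x. - \<psi> x) \<phi> q = - qblock w \<psi> \<phi> q"
  unfolding qblock_def sum_negf[symmetric] by simp

lemma qweight_uminus: "qweight w (\<lambda>x. - \<psi> x) = qweight w \<psi>"
  by (simp add: qweight_def fun_eq_iff)

lemma qblock_ge:
  assumes "h > 0"
  shows "- (h * qweight w \<psi> q + qweight w \<phi> q / h) \<le> 2 * qblock w \<psi> \<phi> q"
  using qblock_le[OF assms, of w "\<lambda>x. - \<psi> x" \<phi> q] by (simp add: qblock_uminus qweight_uminus)

text \<open>Only blocks with different answers change. Such a block is bounded in absolute value by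
  half of the weighted sum, before the query and, since \<open>qweight\<close> is preserved, after
  it; so it falls by at most the whole sum.\<close>

lemma Re_qinner_qoracle_ge:
  assumes "\<And>q. q \<in> {..<n} \<times> {..<n} \<Longrightarrow> h q > 0"
  shows "Re (qinner n w \<psi> \<phi>) - (\<Sum>q\<in>{..<n} \<times> {..<n}. if M $$ q \<noteq> M' $$ q
      then h q * qweight w \<psi> q + qweight w \<phi> q / h q else 0)
    \<le> Re (qinner n w (qoracle M \<psi>) (qoracle M' \<phi>))"
  unfolding Re_qinner_blocks sum_subtractf[symmetric]
proof (rule sum_mono)
  fix q assume "q \<in> {..<n} \<times> {..<n}"
  then have h: "h q > 0" by (rule assms)
  show "qblock w \<psi> \<phi> q - (if M $$ q \<noteq> M' $$ q then h q * qweight w \<psi> q + qweight w \<phi> q / h q else 0)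
    \<le> qblock w (qoracle M \<psi>) (qoracle M' \<phi>) q"
  proof (cases "M $$ q = M' $$ q")
    case True
    then show ?thesis by (simp add: qblock_qoracle_eq)
  next
    case False
    then show ?thesis
      using qblock_le[OF h, of w \<psi> \<phi> q] qblock_ge[OF h, of w "qoracle M \<psi>" q "qoracle M' \<phi>"] by simp
  qed
qed

lemma overlap_of_distinguished_states:
  assumes norm: "Re (qinner n w \<psi> \<psi>) = 1" "Re (qinner n w \<phi> \<phi>) = 1"
    and succ: "qprob n w \<psi> f A \<ge> 2 / 3" "qprob n w \<phi> f B \<ge> 2 / 3" and "A \<noteq> B"
  shows "Re (qinner n w \<psi> \<phi>) \<le> 17 / 18"
proof -
  let ?S = "qspace n w"
  let ?T = "{x\<in>?S. f x = A}"
  let ?g = "\<lambda>\<psi> x. (cmod (\<psi> x))\<^sup>2"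
  have split: "sum F ?S = sum F ?T + sum F (?S - ?T)" for F :: "qbasis \<Rightarrow> real"
    using sum.subset_diff[of ?T ?S F] by simp
  have "qprob n w \<phi> f B \<le> sum (?g \<phi>) (?S - ?T)"
    unfolding qprob_def using \<open>A \<noteq> B\<close> by (intro sum_mono2) auto
  then have q: "sum (?g \<phi>) (?S - ?T) \<ge> 2 / 3" using succ by simp
  have p: "sum (?g \<psi>) ?T \<ge> 2 / 3" using succ by (simp add: qprob_def)
  have part: "2 * (\<Sum>x\<in>V. Re (cnj (\<psi> x) * \<phi> x)) \<le> h * sum (?g \<psi>) V + sum (?g \<phi>) V / h"
    if "h > 0" for h and V :: "qbasis set"
  proof -
    have "2 * (\<Sum>x\<in>V. Re (cnj (\<psi> x) * \<phi> x)) \<le> (\<Sum>x\<in>V. h * ?g \<psi> x + ?g \<phi> x / h)"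
      unfolding sum_distrib_left by (intro sum_mono two_Re_le_weighted_squares that)
    then show ?thesis by (simp add: sum.distrib sum_distrib_left sum_divide_distrib)
  qed
  have "Re (qinner n w \<psi> \<phi>) = (\<Sum>x\<in>?T. Re (cnj (\<psi> x) * \<phi> x)) + (\<Sum>x\<in>?S-?T. Re (cnj (\<psi> x) * \<phi> x))"
    unfolding qinner_def Re_sum by (rule split)
  moreover have "sum (?g \<psi>) ?T + sum (?g \<psi>) (?S - ?T) = 1" "sum (?g \<phi>) ?T + sum (?g \<phi>) (?S - ?T) = 1"
    using norm by (simp_all flip: split add: Re_qinner_self)
  \<comment> \<open>Let p be the weight of \<psi> on T and q that of \<phi> off T. Taking h = 3/4 on
    T and 4/3 off T bounds twice the overlap by 8/3 - 7/12 (p + q) \<le> 17/9; the values are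
    rational substitutes for 1 / sqrt 2 and sqrt 2.\<close>
  ultimately show ?thesis
    using p q part[of "3/4" ?T] part[of "4/3" "?S - ?T"] by simp
qed

text \<open>The adversary weights: a row swap changes a given 0-entry in at most one way, but a given
  1-entry in \<open>n - 1\<close> ways; \<open>1 / sqrt (n - 1)\<close> and \<open>sqrt (n - 1)\<close> balance the two.\<close>

definition adv_weight :: "nat \<Rightarrow> (nat \<Rightarrow> nat) \<Rightarrow> nat \<times> nat \<Rightarrow> real" where
  "adv_weight n \<pi> q = (if \<pi> (fst q) = snd q then 1 / sqrt (real n - 1) else sqrt (real n - 1))"

definition distinguishes :: "(nat \<Rightarrow> nat) \<Rightarrow> (nat \<Rightarrow> nat) \<Rightarrow> nat \<times> nat \<Rightarrow> bool" where
  "distinguishes \<pi> \<rho> q \<longleftrightarrow> (\<pi> (fst q) = snd q) \<noteq> (\<rho> (fst q) = snd q)"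

lemma perm_mat_neq_iff_distinguishes:
  "q \<in> {..<n} \<times> {..<n} \<Longrightarrow> perm_mat n \<pi> $$ q \<noteq> perm_mat n \<rho> $$ q \<longleftrightarrow> distinguishes \<pi> \<rho> q"
  by (auto simp: distinguishes_def split: if_splits)

lemma adv_weight_pos: "n \<ge> 2 \<Longrightarrow> adv_weight n \<pi> q > 0"
  by (simp add: adv_weight_def)

text \<open>Exactly one of the two permutations has a 1 at q. Thus the factors h and 1 / h in the
  estimate for a pair are the weights of its two ends.\<close>

lemma adv_weight_distinguishes: "distinguishes \<pi> \<rho> q \<Longrightarrow> adv_weight n \<rho> q = 1 / adv_weight n \<pi> q"
  by (auto simp: adv_weight_def distinguishes_def)

lemma adv_weight_degree:
  assumes \<pi>: "\<pi> permutes {..<n}" and q: "q \<in> {..<n} \<times> {..<n}" and n: "n \<ge> 2"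
  shows "adv_weight n \<pi> q * card {e \<in> row_pairs n. distinguishes \<pi> (swap_rows \<pi> e) q} \<le> sqrt (real n - 1)"
proof (cases "\<pi> (fst q) = snd q")
  case True
  then have "{e \<in> row_pairs n. distinguishes \<pi> (swap_rows \<pi> e) q} = {e \<in> row_pairs n. swap_rows \<pi> e (fst q) \<noteq> \<pi> (fst q)}"
    by (auto simp: distinguishes_def)
  then have "card {e \<in> row_pairs n. distinguishes \<pi> (swap_rows \<pi> e) q} \<le> n - 1"
    using card_swap_rows_moving[OF \<pi>, of "fst q"] q by auto
  then have "real (card {e \<in> row_pairs n. distinguishes \<pi> (swap_rows \<pi> e) q}) \<le> sqrt (real n - 1) * sqrt (real n - 1)"
    using n by simp
  then show ?thesis using True n by (simp add: adv_weight_def divide_le_eq)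
next
  case False
  then have "{e \<in> row_pairs n. distinguishes \<pi> (swap_rows \<pi> e) q} = {e \<in> row_pairs n. swap_rows \<pi> e (fst q) = snd q}"
    by (auto simp: distinguishes_def)
  then have "card {e \<in> row_pairs n. distinguishes \<pi> (swap_rows \<pi> e) q} \<le> 1"
    using card_swap_rows_hitting_zero[OF \<pi> False] by simp
  then have "sqrt (real n - 1) * card {e \<in> row_pairs n. distinguishes \<pi> (swap_rows \<pi> e) q} \<le> sqrt (real n - 1) * 1"
    using n by (intro mult_left_mono) auto
  then show ?thesis using False by (simp add: adv_weight_def)
qed

text \<open>The loss of a pair is split into a share c for each end. For fixed \<pi> and q the
  shares over all swaps are at most sqrt (n - 1) times the weight of q, and the weights of a unit
  vector sum to 1. The factor 2 counts the two ends.\<close>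

lemma adversary_progress_step:
  fixes \<psi> :: "(nat \<Rightarrow> nat) \<Rightarrow> qstate"
  assumes n: "n \<ge> 2" and norm: "\<And>\<pi>. \<pi> permutes {..<n} \<Longrightarrow> Re (qinner n w (\<psi> \<pi>) (\<psi> \<pi>)) = 1"
  shows "(\<Sum>\<pi> | \<pi> permutes {..<n}. \<Sum>e\<in>row_pairs n. Re (qinner n w (\<psi> \<pi>) (\<psi> (swap_rows \<pi> e))))
      - 2 * sqrt (real n - 1) * card {\<pi>. \<pi> permutes {..<n}}
    \<le> (\<Sum>\<pi> | \<pi> permutes {..<n}. \<Sum>e\<in>row_pairs n. Re (qinner n w
        (qoracle (perm_mat n \<pi>) (\<psi> \<pi>)) (qoracle (perm_mat n (swap_rows \<pi> e)) (\<psi> (swap_rows \<pi> e)))))"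
    (is "?L - _ \<le> ?R")
proof -
  let ?P = "{\<pi>. \<pi> permutes {..<n}}" and ?E = "row_pairs n" and ?Q = "{..<n} \<times> {..<n}"
  define c where "c \<pi> e q = (if distinguishes \<pi> (swap_rows \<pi> e) q then adv_weight n \<pi> q * qweight w (\<psi> \<pi>) q else 0)"
    for \<pi> e q
  have dist_sym: "distinguishes \<rho> \<pi> q \<longleftrightarrow> distinguishes \<pi> \<rho> q" for \<pi> \<rho> q
    by (auto simp: distinguishes_def)
  have half: "(\<Sum>\<pi>\<in>?P. \<Sum>e\<in>?E. \<Sum>q\<in>?Q. c \<pi> e q) \<le> sqrt (real n - 1) * card ?P"
  proof -
    have "(\<Sum>e\<in>?E. \<Sum>q\<in>?Q. c \<pi> e q) \<le> sqrt (real n - 1)" if \<pi>: "\<pi> permutes {..<n}" for \<pi>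
    proof -
      have "(\<Sum>e\<in>?E. \<Sum>q\<in>?Q. c \<pi> e q) = (\<Sum>q\<in>?Q. \<Sum>e\<in>?E. c \<pi> e q)"
        by (rule sum.swap)
      also have "\<dots> = (\<Sum>q\<in>?Q. adv_weight n \<pi> q * card {e \<in> ?E. distinguishes \<pi> (swap_rows \<pi> e) q} * qweight w (\<psi> \<pi>) q)"
        by (intro sum.cong[OF refl]) (simp add: c_def sum.If_cases Int_def)
      also have "\<dots> \<le> (\<Sum>q\<in>?Q. sqrt (real n - 1) * qweight w (\<psi> \<pi>) q)"
        by (intro sum_mono mult_right_mono adv_weight_degree \<pi> n) (auto simp: qweight_def intro: sum_nonneg)
      also have "\<dots> = sqrt (real n - 1)"
        using norm[OF \<pi>] by (simp add: sum_qweight flip: sum_distrib_left)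
      finally show ?thesis .
    qed
    then have "(\<Sum>\<pi>\<in>?P. \<Sum>e\<in>?E. \<Sum>q\<in>?Q. c \<pi> e q) \<le> (\<Sum>\<pi>\<in>?P. sqrt (real n - 1))"
      by (intro sum_mono) auto
    then show ?thesis by (simp add: mult.commute)
  qed
  have "?L - (\<Sum>\<pi>\<in>?P. \<Sum>e\<in>?E. \<Sum>q\<in>?Q. c \<pi> e q + c (swap_rows \<pi> e) e q) \<le> ?R"
    unfolding sum_subtractf[symmetric]
  proof (intro sum_mono)
    fix \<pi> e assume "\<pi> \<in> ?P" "e \<in> ?E"
    have "(\<Sum>q\<in>?Q. c \<pi> e q + c (swap_rows \<pi> e) e q) =
      (\<Sum>q\<in>?Q. if perm_mat n \<pi> $$ q \<noteq> perm_mat n (swap_rows \<pi> e) $$ q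
        then adv_weight n \<pi> q * qweight w (\<psi> \<pi>) q + qweight w (\<psi> (swap_rows \<pi> e)) q / adv_weight n \<pi> q else 0)"
    proof (rule sum.cong[OF refl])
      fix q assume q: "q \<in> ?Q"
      show "c \<pi> e q + c (swap_rows \<pi> e) e q = (if perm_mat n \<pi> $$ q \<noteq> perm_mat n (swap_rows \<pi> e) $$ q
        then adv_weight n \<pi> q * qweight w (\<psi> \<pi>) q + qweight w (\<psi> (swap_rows \<pi> e)) q / adv_weight n \<pi> q else 0)"
        unfolding perm_mat_neq_iff_distinguishes[OF q]
        using dist_sym[of "swap_rows \<pi> e" \<pi> q] adv_weight_distinguishes[of \<pi> "swap_rows \<pi> e" q n]
        by (simp add: c_def)
    qed
    then show "Re (qinner n w (\<psi> \<pi>) (\<psi> (swap_rows \<pi> e))) - (\<Sum>q\<in>?Q. c \<pi> e q + c (swap_rows \<pi> e) e q)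
      \<le> Re (qinner n w (qoracle (perm_mat n \<pi>) (\<psi> \<pi>)) (qoracle (perm_mat n (swap_rows \<pi> e)) (\<psi> (swap_rows \<pi> e))))"
      using Re_qinner_qoracle_ge[of n "adv_weight n \<pi>" w "\<psi> \<pi>" "\<psi> (swap_rows \<pi> e)" "perm_mat n \<pi>" "perm_mat n (swap_rows \<pi> e)"]
        adv_weight_pos[OF n] by simp
  qed
  also have "(\<Sum>\<pi>\<in>?P. \<Sum>e\<in>?E. \<Sum>q\<in>?Q. c \<pi> e q + c (swap_rows \<pi> e) e q)
    = (\<Sum>\<pi>\<in>?P. \<Sum>e\<in>?E. \<Sum>q\<in>?Q. c \<pi> e q) + (\<Sum>\<pi>\<in>?P. \<Sum>e\<in>?E. \<Sum>q\<in>?Q. c (swap_rows \<pi> e) e q)"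
    by (simp add: sum.distrib)
  also have "(\<Sum>\<pi>\<in>?P. \<Sum>e\<in>?E. \<Sum>q\<in>?Q. c (swap_rows \<pi> e) e q) = (\<Sum>e\<in>?E. \<Sum>\<pi>\<in>?P. \<Sum>q\<in>?Q. c (swap_rows \<pi> e) e q)"
    by (rule sum.swap)
  also have "\<dots> = (\<Sum>e\<in>?E. \<Sum>\<pi>\<in>?P. \<Sum>q\<in>?Q. c \<pi> e q)"
    by (rule sum.cong[OF refl]) (rule sum_swap_rows)
  also have "\<dots> = (\<Sum>\<pi>\<in>?P. \<Sum>e\<in>?E. \<Sum>q\<in>?Q. c \<pi> e q)"
    by (rule sum.swap)
  finally show ?thesis using half by linarith
qed

lemma qinner_qinit:
  assumes "n > 0" "w > 0"
  shows "qinner n w qinit qinit = 1"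
proof -
  have "((0, 0), 0, 0) \<in> qspace n w" using assms by (simp add: qspace_def)
  then show ?thesis by (simp add: qinner_def qinit_def if_distrib sum.delta cong: if_cong)
qed

lemma qinner_qoracle_self: "Re (qinner n w (qoracle M \<psi>) (qoracle M \<psi>)) = Re (qinner n w \<psi> \<psi>)"
  by (simp flip: sum_qweight)

lemma qrun_norm:
  assumes "n > 0" "w > 0" "\<And>j. j \<le> k \<Longrightarrow> qunitary n w (U j)"
  shows "Re (qinner n w (qrun n w U M k) (qrun n w U M k)) = 1"
  using assms(3) by (induction k) (simp_all add: qinner_qapply qinner_qinit qinner_qoracle_self assms)

lemma quantum_lower_bound:
  assumes n: "n \<ge> 2" and w: "w > 0" and U: "\<And>k. k \<le> d \<Longrightarrow> qunitary n w (U k)"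
    and succ: "\<And>\<pi>. \<pi> permutes {..<n} \<Longrightarrow>
      qprob n w (qrun n w U (perm_mat n \<pi>) d) f (perm_mat n \<pi>) \<ge> 2 / 3"
  shows "real n * sqrt (real n - 1) \<le> 72 * real d"
proof -
  let ?P = "{\<pi>. \<pi> permutes {..<n}}" and ?E = "row_pairs n"
  define s where "s = sqrt (real n - 1)"
  define \<psi> where "\<psi> k \<pi> = qrun n w U (perm_mat n \<pi>) k" for k \<pi>
  define W where "W k = (\<Sum>\<pi>\<in>?P. \<Sum>e\<in>?E. Re (qinner n w (\<psi> k \<pi>) (\<psi> k (swap_rows \<pi> e))))" for k
  have s: "s > 0" "s * s = real n - 1" using n by (simp_all add: s_def)
  have N: "real (n choose 2) = real n * (s * s) / 2"
    unfolding s(2) using n by (simp add: choose_two real_of_nat_div of_nat_diff)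
  have P: "card ?P > 0"
    using permutes_id[of "{..<n}"] finite_permutations[of "{..<n}"] card_gt_0_iff by blast
  have norm: "Re (qinner n w (\<psi> k \<pi>) (\<psi> k \<pi>)) = 1" if "k \<le> d" for k \<pi>
    unfolding \<psi>_def using that n w U by (intro qrun_norm) auto
  \<comment> \<open>Before the first query the state does not depend on the input, so every pair
    contributes 1.\<close>
  have W0: "W 0 = real (card ?P) * real (n choose 2)"
    using U[of 0] n w by (simp add: W_def \<psi>_def qinner_qapply qinner_qinit card_row_pairs)
  have step: "W k - 2 * s * card ?P \<le> W (Suc k)" if "k < d" for k
    using adversary_progress_step[OF n, of w "\<psi> k"] norm[of k] U[of "Suc k"] that
    by (simp add: W_def \<psi>_def qinner_qapply s_def)
  have lower: "W 0 - real k * (2 * s * real (card ?P)) \<le> W k" if "k \<le> d" for k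
    using that
  proof (induction k)
    case (Suc k)
    then show ?case using step[of k] by (simp add: algebra_simps)
  qed simp
  have "W d \<le> (\<Sum>\<pi>\<in>?P. \<Sum>e\<in>?E. 17 / 18)"
    unfolding W_def
  proof (intro sum_mono)
    fix \<pi> e assume "\<pi> \<in> ?P" "e \<in> ?E"
    moreover from this have "perm_mat n \<pi> \<noteq> perm_mat n (swap_rows \<pi> e)"
      using swap_rows_neq[of \<pi> n e] by (subst perm_mat_eq_iff) auto
    ultimately show "Re (qinner n w (\<psi> d \<pi>) (\<psi> d (swap_rows \<pi> e))) \<le> 17 / 18"
      using succ[of \<pi>] succ[of "swap_rows \<pi> e"]
      by (intro overlap_of_distinguished_states[OF norm norm]) (auto simp: \<psi>_def)
  qed
  also have "\<dots> = real (card ?P) * real (n choose 2) * (17 / 18)"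
    by (simp add: card_row_pairs)
  finally have "real (card ?P) * real (n choose 2) - real d * (2 * s * real (card ?P)) \<le> real (card ?P) * real (n choose 2) * (17 / 18)"
    using lower[of d] W0 by linarith
  then have "real (card ?P) * (real (n choose 2) / 18) \<le> real (card ?P) * (2 * s * real d)"
    by (simp add: field_simps)
  then have "real (n choose 2) / 18 \<le> 2 * s * real d" using P by simp
  \<comment> \<open>Since (n choose 2) = n s^2 / 2, the constant is 72 = 2 * 18 * 2.\<close>
  then have "(real n * s) * s \<le> (72 * real d) * s" unfolding N by (simp add: field_simps)
  then have "real n * s \<le> 72 * real d" using s(1) by (simp only: mult_le_cancel_right_pos)
  then show ?thesis by (simp add: s_def)
qed

section \<open>Quantum algorithm\<close>

definition rinner :: "'a set \<Rightarrow> ('a \<Rightarrow> real) \<Rightarrow> ('a \<Rightarrow> real) \<Rightarrow> real" where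
  "rinner S u v = (\<Sum>x\<in>S. u x * v x)"

definition orthogonal_on :: "'a set \<Rightarrow> ('a \<Rightarrow> 'a \<Rightarrow> real) \<Rightarrow> bool" where
  "orthogonal_on S U \<longleftrightarrow> (\<forall>x\<in>S. \<forall>y\<in>S. rinner S (\<lambda>z. U z x) (\<lambda>z. U z y) = (if x = y then 1 else 0))"

text \<open>The reflection in the hyperplane orthogonal to h. If h vanishes on S, division by 0
  makes it the identity, which is right when the vectors to be exchanged already agree.\<close>

definition householder :: "'a set \<Rightarrow> ('a \<Rightarrow> real) \<Rightarrow> ('a \<Rightarrow> real) \<Rightarrow> 'a \<Rightarrow> real" where
  "householder S h u = (\<lambda>x. u x - 2 * rinner S h u / rinner S h h * h x)"

lemma rinner_commute: "rinner S u v = rinner S v u"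
  by (simp add: rinner_def mult.commute)

lemma rinner_diff_left: "rinner S (\<lambda>x. u x - v x) z = rinner S u z - rinner S v z"
  by (simp add: rinner_def left_diff_distrib sum_subtractf)

lemma rinner_diff_right: "rinner S z (\<lambda>x. u x - v x) = rinner S z u - rinner S z v"
  by (simp add: rinner_def right_diff_distrib sum_subtractf)

lemma rinner_scale_left: "rinner S (\<lambda>x. c * u x) v = c * rinner S u v"
  by (simp add: rinner_def sum_distrib_left mult_ac)

lemma rinner_scale_right: "rinner S u (\<lambda>x. c * v x) = c * rinner S u v"
  by (simp add: rinner_def sum_distrib_left mult_ac)

lemma rinner_sum_right: "rinner S u (\<lambda>x. \<Sum>y\<in>T. f x y * c y) = (\<Sum>y\<in>T. rinner S u (\<lambda>x. f x y) * c y)"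
  unfolding rinner_def sum_distrib_left sum_distrib_right by (subst sum.swap) (simp add: mult_ac)

lemma rinner_cong: "(\<And>x. x \<in> S \<Longrightarrow> u x = u' x) \<Longrightarrow> (\<And>x. x \<in> S \<Longrightarrow> v x = v' x) \<Longrightarrow> rinner S u v = rinner S u' v'"
  by (simp add: rinner_def)

lemma rinner_householder:
  "rinner S (householder S h u) (householder S h v) = rinner S u v"
proof (cases "rinner S h h = 0")
  case False
  then show ?thesis
    unfolding householder_def rinner_diff_left rinner_diff_right rinner_scale_left rinner_scale_right
      rinner_commute[of S u h]
    by (simp add: field_simps)
qed (simp add: householder_def)

lemma rinner_self_eq_0_iff: "finite S \<Longrightarrow> rinner S u u = 0 \<longleftrightarrow> (\<forall>x\<in>S. u x = 0)"
  by (simp add: rinner_def sum_nonneg_eq_0_iff)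

lemma householder_orthogonal: "rinner S h u = 0 \<Longrightarrow> householder S h u = u"
  by (simp add: householder_def)

text \<open>For equal norms the squared norm of h = u - v is twice the inner product of h and u, so
  the reflection subtracts u - v from u exactly once.\<close>

lemma householder_diff:
  assumes "finite S" "rinner S u u = rinner S v v" "x \<in> S"
  shows "householder S (\<lambda>x. u x - v x) u x = v x"
proof -
  define h where "h = (\<lambda>x. u x - v x)"
  have hh: "rinner S h h = 2 * rinner S h u"
    using assms(2) by (simp add: h_def rinner_diff_left rinner_diff_right rinner_commute[of S v u])
  show ?thesis
  proof (cases "rinner S h h = 0")
    case True
    then have "h x = 0" using rinner_self_eq_0_iff[OF assms(1), of h] assms(3) by simp
    then show ?thesis using True hh by (simp add: householder_def flip: h_def) (simp add: h_def)
  next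
    case False
    then show ?thesis using hh by (simp add: householder_def flip: h_def) (simp add: h_def)
  qed
qed

lemma householder_sum:
  "householder S h (\<lambda>x. \<Sum>y\<in>T. U x y * u y) x = (\<Sum>y\<in>T. householder S h (\<lambda>x. U x y) x * u y)"
  unfolding householder_def rinner_sum_right
  by (simp add: left_diff_distrib right_diff_distrib sum_subtractf sum_distrib_left sum_distrib_right sum_divide_distrib mult_ac)

lemma rinner_orthogonal_on:
  assumes "finite S" "orthogonal_on S U"
  shows "rinner S (\<lambda>x. \<Sum>y\<in>S. U x y * u y) (\<lambda>x. \<Sum>y\<in>S. U x y * v y) = rinner S u v"
proof -
  have "rinner S (\<lambda>x. \<Sum>y\<in>S. U x y * u y) (\<lambda>x. \<Sum>y\<in>S. U x y * v y) =
    (\<Sum>y\<in>S. (\<Sum>z\<in>S. rinner S (\<lambda>x. U x y) (\<lambda>x. U x z) * u z) * v y)"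
    unfolding rinner_sum_right by (subst rinner_commute) (simp add: rinner_sum_right)
  also have "\<dots> = (\<Sum>y\<in>S. (\<Sum>z\<in>S. (if y = z then 1 else 0) * u z) * v y)"
    using assms(2) by (simp add: orthogonal_on_def)
  also have "\<dots> = rinner S u v"
    using assms(1) by (simp add: rinner_def if_distrib[of "\<lambda>t. t * _"] sum.delta cong: if_cong)
  finally show ?thesis .
qed

text \<open>Vectors are treated one at a time. If U is right on I, it is followed by the reflection
  along h = U u_k - v_k, which takes U u_k to v_k. It fixes every earlier v_i, as equality of the
  Gram matrices makes v_i orthogonal to h.\<close>

lemma orthogonal_of_equal_gram:
  fixes u v :: "'i \<Rightarrow> 'a \<Rightarrow> real"
  assumes "finite I" "finite S"
    and "\<And>i j. i \<in> I \<Longrightarrow> j \<in> I \<Longrightarrow> rinner S (u i) (u j) = rinner S (v i) (v j)"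
  shows "\<exists>U. orthogonal_on S U \<and> (\<forall>i\<in>I. \<forall>x\<in>S. (\<Sum>y\<in>S. U x y * u i y) = v i x)"
  using assms(1,3)
proof (induction I rule: finite_induct)
  case empty
  have "orthogonal_on S (\<lambda>x y. if x = y then 1 else 0)"
    using assms(2) by (auto simp: orthogonal_on_def rinner_def if_distrib[of "\<lambda>t. t * _"] sum.delta cong: if_cong)
  then show ?case by auto
next
  case (insert k I)
  then obtain U where U: "orthogonal_on S U" "\<forall>i\<in>I. \<forall>x\<in>S. (\<Sum>y\<in>S. U x y * u i y) = v i x"
    by auto
  define u' where "u' = (\<lambda>x. \<Sum>y\<in>S. U x y * u k y)"
  define h where "h = (\<lambda>x. u' x - v k x)"
  define V where "V = (\<lambda>x y. householder S h (\<lambda>z. U z y) x)"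
  have V: "(\<Sum>y\<in>S. V x y * u i y) = householder S h (\<lambda>x. \<Sum>y\<in>S. U x y * u i y) x" for i x
    unfolding V_def by (rule householder_sum[symmetric])
  have "orthogonal_on S V"
    using U(1) by (simp add: orthogonal_on_def V_def rinner_householder)
  moreover have "(\<Sum>y\<in>S. V x y * u i y) = v i x" if "i \<in> insert k I" "x \<in> S" for i x
  proof (cases "i = k")
    case True
    have "rinner S u' u' = rinner S (v k) (v k)"
      unfolding u'_def using rinner_orthogonal_on[OF assms(2) U(1)] insert.prems[of k k] by simp
    then show ?thesis
      unfolding V True using householder_diff[OF assms(2) _ that(2), of u' "v k"] by (simp add: u'_def h_def)
  next
    case False
    then have i: "i \<in> I" using that by simp
    have 1: "rinner S f (\<lambda>x. \<Sum>y\<in>S. U x y * u i y) = rinner S f (v i)" for f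
      by (rule rinner_cong) (use U(2) i in auto)
    have "rinner S u' (\<lambda>x. \<Sum>y\<in>S. U x y * u i y) = rinner S (v k) (v i)"
      unfolding u'_def using rinner_orthogonal_on[OF assms(2) U(1)] insert.prems[of k i] i by simp
    then have "rinner S h (\<lambda>x. \<Sum>y\<in>S. U x y * u i y) = 0"
      unfolding h_def rinner_diff_left by (simp add: 1)
    then show ?thesis unfolding V using U(2) i that(2) by (simp add: householder_orthogonal)
  qed
  ultimately show ?case by blast
qed

section \<open>Algorithms with prescribed states\<close>

definition roracle :: "bit mat \<Rightarrow> (qbasis \<Rightarrow> real) \<Rightarrow> qbasis \<Rightarrow> real" where
  "roracle M \<psi> = (\<lambda>(q, b, a). \<psi> (q, b + M $$ q, a))"

lemma qunitary_of_orthogonal_on: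
  "orthogonal_on (qspace n w) U \<Longrightarrow> qunitary n w (\<lambda>x y. of_real (U x y))"
  unfolding qunitary_def orthogonal_on_def rinner_def
  by (metis (no_types, lifting) complex_cnj_complex_of_real of_real_0 of_real_1 of_real_mult of_real_sum sum.cong)

lemma qapply_of_real:
  assumes "\<And>y. y \<in> qspace n w \<Longrightarrow> \<psi> y = of_real (u y)"
  shows "qapply n w (\<lambda>x y. of_real (U x y)) \<psi> x = of_real (\<Sum>y\<in>qspace n w. U x y * u y)"
  by (simp add: qapply_def assms)

text \<open>An algorithm with a prescribed run exists as soon as the states after each query and the
  next states to be queried have the same Gram matrix.\<close>

lemma prescribed_run:
  fixes \<phi> :: "nat \<Rightarrow> 'i \<Rightarrow> qbasis \<Rightarrow> real"
  assumes "finite I" "n > 0" "w > 0"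
    and init: "\<And>i j. i \<in> I \<Longrightarrow> j \<in> I \<Longrightarrow> rinner (qspace n w) (\<phi> 0 i) (\<phi> 0 j) = 1"
    and step: "\<And>k i j. k < d \<Longrightarrow> i \<in> I \<Longrightarrow> j \<in> I \<Longrightarrow>
      rinner (qspace n w) (roracle (M i) (\<phi> k i)) (roracle (M j) (\<phi> k j)) =
      rinner (qspace n w) (\<phi> (Suc k) i) (\<phi> (Suc k) j)"
  shows "\<exists>U. (\<forall>k\<le>d. qunitary n w (U k)) \<and>
    (\<forall>k\<le>d. \<forall>i\<in>I. \<forall>x\<in>qspace n w. qrun n w U (M i) k x = of_real (\<phi> k i x))"
proof -
  let ?S = "qspace n w"
  \<comment> \<open>The vector on which the k-th unitary acts: the initial state, or the previous
    state after its query.\<close>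
  define src where "src k i = (case k of 0 \<Rightarrow> (\<lambda>x. if x = ((0, 0), 0, 0) then 1 else 0)
    | Suc k \<Rightarrow> roracle (M i) (\<phi> k i))" for k i
  have "\<exists>U. orthogonal_on ?S U \<and> (\<forall>i\<in>I. \<forall>x\<in>?S. (\<Sum>y\<in>?S. U x y * src k i y) = \<phi> k i x)" if "k \<le> d" for k
  proof (rule orthogonal_of_equal_gram[OF assms(1)])
    fix i j assume ij: "i \<in> I" "j \<in> I"
    show "rinner ?S (src k i) (src k j) = rinner ?S (\<phi> k i) (\<phi> k j)"
    proof (cases k)
      case 0
      have "((0, 0), 0, 0) \<in> ?S" using assms by (simp add: qspace_def)
      then have "rinner ?S (src k i) (src k j) = 1"
        by (simp add: 0 src_def rinner_def if_distrib[of "\<lambda>t. t * _"] sum.delta cong: if_cong)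
      then show ?thesis using init[OF ij] 0 by simp
    next
      case (Suc k')
      then show ?thesis using step[OF _ ij, of k'] that by (simp add: src_def)
    qed
  qed simp
  then obtain V where V: "\<And>k. k \<le> d \<Longrightarrow> orthogonal_on ?S (V k)"
    "\<And>k i x. k \<le> d \<Longrightarrow> i \<in> I \<Longrightarrow> x \<in> ?S \<Longrightarrow> (\<Sum>y\<in>?S. V k x y * src k i y) = \<phi> k i x"
    by metis
  define U where "U k = (\<lambda>x y. complex_of_real (V k x y))" for k
  have "qrun n w U (M i) k x = of_real (\<phi> k i x)" if "k \<le> d" "i \<in> I" "x \<in> ?S" for k i x
    using that
  proof (induction k arbitrary: x)
    case 0
    have "qrun n w U (M i) 0 x = of_real (\<Sum>y\<in>?S. V 0 x y * src 0 i y)"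
      unfolding qrun.simps U_def by (rule qapply_of_real) (simp add: qinit_def src_def)
    then show ?case using 0 V(2) by simp
  next
    case (Suc k)
    have "qrun n w U (M i) (Suc k) x = of_real (\<Sum>y\<in>?S. V (Suc k) x y * src (Suc k) i y)"
      unfolding qrun.simps U_def[of "Suc k"]
    proof (rule qapply_of_real)
      fix y assume "y \<in> ?S"
      then show "qoracle (M i) (qrun n w U (M i) k) y = of_real (src (Suc k) i y)"
        using Suc by (auto simp: qoracle_def src_def roracle_def qspace_def)
    qed
    then show ?case using Suc.prems V(2) by simp
  qed
  moreover have "qunitary n w (U k)" if "k \<le> d" for k
    unfolding U_def by (rule qunitary_of_orthogonal_on) (rule V(1)[OF that])
  ultimately show ?thesis by blast
qed

text \<open>The states used to search row \<open>i\<close>: the query register holds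
  \<open>\<alpha>|(i, \<pi> i)\<rangle> + \<beta> \<Sum>\<^sub>c |(i, c)\<rangle>\<close>, \<open>c \<noteq> \<pi> i\<close>, with answer register \<open>|-\<rangle>\<close>, so that the query negates \<open>\<alpha>\<close>.
  The component \<open>\<gamma>\<close> with answer register \<open>|+\<rangle>\<close> is not affected by the query, and the label \<open>e\<close>
  encodes the rows known so far.\<close>

definition row_state ::
    "(nat \<Rightarrow> nat) \<Rightarrow> nat \<Rightarrow> real \<Rightarrow> real \<Rightarrow> real \<Rightarrow> nat \<Rightarrow> qbasis \<Rightarrow> real" where
  "row_state \<pi> i \<alpha> \<beta> \<gamma> e = (\<lambda>(q, b, a). if a = e then
     ((if b = 0 then 1 else - 1) * (if fst q = i then if snd q = \<pi> i then \<alpha> else \<beta> else 0)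
      + (if q = (0, 0) then \<gamma> else 0)) / sqrt 2 else 0)"

text \<open>Phase kickback: where the entry is 1, the query exchanges the two values of b. This
  negates the part in |->, whose amplitude there is \<alpha> in row i and 0 in other rows, and fixes
  the part in |+>.\<close>

lemma roracle_row_state:
  assumes "x \<in> qspace n w" "i < n"
  shows "roracle (perm_mat n \<pi>) (row_state \<pi> i \<alpha> \<beta> \<gamma> e) x = row_state \<pi> i (- \<alpha>) \<beta> \<gamma> e x"
proof -
  obtain r c b a where x: "x = ((r, c), b, a)" by (metis surj_pair)
  have "r < n" "c < n" using assms(1) by (auto simp: x qspace_def)
  then show ?thesis
    by (cases b) (auto simp: x roracle_def row_state_def)
qed

text \<open>Different labels are orthogonal, and the sum over b cancels the cross terms of |-> and
  |+>.\<close>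

lemma rinner_row_state:
  assumes "i < n" "e < w" "e' < w"
  shows "rinner (qspace n w) (row_state \<pi> i \<alpha> \<beta> \<gamma> e) (row_state \<rho> i \<alpha> \<beta> \<gamma> e') =
    (if e = e' then (\<Sum>c<n. (if c = \<pi> i then \<alpha> else \<beta>) * (if c = \<rho> i then \<alpha> else \<beta>)) + \<gamma>\<^sup>2 else 0)"
proof -
  let ?x = "\<lambda>\<pi> q. if fst q = i then if snd q = \<pi> i then \<alpha> else \<beta> else 0"
  let ?g = "\<lambda>q. if q = (0, 0) then \<gamma> else 0"
  let ?Q = "{..<n} \<times> {..<n}"
  have "rinner (qspace n w) (row_state \<pi> i \<alpha> \<beta> \<gamma> e) (row_state \<rho> i \<alpha> \<beta> \<gamma> e') =
    (\<Sum>q\<in>?Q. \<Sum>b\<in>{0,1}. \<Sum>a<w. row_state \<pi> i \<alpha> \<beta> \<gamma> e (q, b, a) * row_state \<rho> i \<alpha> \<beta> \<gamma> e' (q, b, a))"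
    unfolding rinner_def qspace_def by (simp only: sum.cartesian_product' bit_UNIV)
  also have "\<dots> = (\<Sum>q\<in>?Q. if e = e' then ?x \<pi> q * ?x \<rho> q + (?g q)\<^sup>2 else 0)"
  proof (rule sum.cong[OF refl])
    fix q
    define X Y G where "X = ?x \<pi> q" and "Y = ?x \<rho> q" and "G = ?g q"
    have "(\<Sum>a<w. row_state \<pi> i \<alpha> \<beta> \<gamma> e (q, b, a) * row_state \<rho> i \<alpha> \<beta> \<gamma> e' (q, b, a)) =
      (if e = e' then ((if b = 0 then 1 else - 1) * X + G) * ((if b = 0 then 1 else - 1) * Y + G) / 2 else 0)" for b
    proof -
      have "(\<Sum>a<w. row_state \<pi> i \<alpha> \<beta> \<gamma> e (q, b, a) * row_state \<rho> i \<alpha> \<beta> \<gamma> e' (q, b, a)) =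
        (\<Sum>a<w. if a = e then row_state \<pi> i \<alpha> \<beta> \<gamma> e (q, b, e) * row_state \<rho> i \<alpha> \<beta> \<gamma> e' (q, b, e) else 0)"
        by (rule sum.cong) (auto simp: row_state_def)
      also have "\<dots> = row_state \<pi> i \<alpha> \<beta> \<gamma> e (q, b, e) * row_state \<rho> i \<alpha> \<beta> \<gamma> e' (q, b, e)"
        using assms by (simp add: sum.delta)
      finally show ?thesis by (simp add: row_state_def X_def Y_def G_def)
    qed
    then have "(\<Sum>b\<in>{0,1}. \<Sum>a<w. row_state \<pi> i \<alpha> \<beta> \<gamma> e (q, b, a) * row_state \<rho> i \<alpha> \<beta> \<gamma> e' (q, b, a)) =
      (if e = e' then X * Y + G\<^sup>2 else 0)"
      by (simp add: field_simps power2_eq_square)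
    then show "(\<Sum>b\<in>{0,1}. \<Sum>a<w. row_state \<pi> i \<alpha> \<beta> \<gamma> e (q, b, a) * row_state \<rho> i \<alpha> \<beta> \<gamma> e' (q, b, a)) =
      (if e = e' then ?x \<pi> q * ?x \<rho> q + (?g q)\<^sup>2 else 0)"
      by (simp only: X_def Y_def G_def)
  qed
  also have "\<dots> = (if e = e' then (\<Sum>q\<in>?Q. ?x \<pi> q * ?x \<rho> q) + (\<Sum>q\<in>?Q. (?g q)\<^sup>2) else 0)"
    by (simp add: sum.distrib)
  also have "(\<Sum>q\<in>?Q. (?g q)\<^sup>2) = \<gamma>\<^sup>2"
    using assms by (simp add: if_distrib[of "\<lambda>t. t\<^sup>2"] sum.delta cong: if_cong)
  also have "(\<Sum>q\<in>?Q. ?x \<pi> q * ?x \<rho> q) = (\<Sum>r<n. \<Sum>c<n. ?x \<pi> (r, c) * ?x \<rho> (r, c))"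
    by (simp only: sum.cartesian_product')
  also have "\<dots> = (\<Sum>r<n. if r = i then (\<Sum>c<n. (if c = \<pi> i then \<alpha> else \<beta>) * (if c = \<rho> i then \<alpha> else \<beta>)) else 0)"
    by (rule sum.cong) auto
  also have "\<dots> = (\<Sum>c<n. (if c = \<pi> i then \<alpha> else \<beta>) * (if c = \<rho> i then \<alpha> else \<beta>))"
    using assms by (simp add: sum.delta)
  finally show ?thesis .
qed

text \<open>Apart from the norm, the overlap for different positions depends on \<alpha> - \<beta>
  only. Negating \<alpha> replaces this by \<alpha> + \<beta> up to sign, which is the progress made
  by a query.\<close>

lemma sum_two_valued:
  fixes \<alpha> \<beta> :: real
  assumes "p < n" "r < n"
  shows "(\<Sum>c<n. (if c = p then \<alpha> else \<beta>) * (if c = r then \<alpha> else \<beta>)) =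
    (if p = r then \<alpha>\<^sup>2 + (real n - 1) * \<beta>\<^sup>2 else \<alpha>\<^sup>2 + (real n - 1) * \<beta>\<^sup>2 - (\<alpha> - \<beta>)\<^sup>2)"
proof -
  have "(\<Sum>c<n. (if c = p then \<alpha> else \<beta>) * (if c = r then \<alpha> else \<beta>)) =
    (\<Sum>c<n. \<beta>\<^sup>2 + (if c = p then \<beta> * (\<alpha> - \<beta>) else 0) + (if c = r then \<beta> * (\<alpha> - \<beta>) else 0)
      + (if c = p then if p = r then (\<alpha> - \<beta>)\<^sup>2 else 0 else 0))"
    by (rule sum.cong) (auto simp: algebra_simps power2_eq_square)
  also have "\<dots> = real n * \<beta>\<^sup>2 + 2 * (\<beta> * (\<alpha> - \<beta>)) + (if p = r then (\<alpha> - \<beta>)\<^sup>2 else 0)"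
    using assms by (simp add: sum.distrib sum.delta)
  finally show ?thesis by (simp only:) (simp add: algebra_simps power2_eq_square)
qed

text \<open>After \<open>r\<close> of \<open>k\<close> queries to a row, the states for different positions of its 1 have inner product
  \<open>1 - (search_dist k r)\<^sup>2\<close>. With \<open>k \<ge> sqrt n\<close> queries they become orthogonal,
  so the row is found with certainty.\<close>

definition search_dist :: "nat \<Rightarrow> nat \<Rightarrow> real" where
  "search_dist k r = 1 - (1 - real r / real k)\<^sup>2"

definition search_gram :: "nat \<Rightarrow> nat \<Rightarrow> nat \<Rightarrow> (nat \<Rightarrow> nat) \<Rightarrow> (nat \<Rightarrow> nat) \<Rightarrow> real" where
  "search_gram k i r \<pi> \<rho> = (if map \<pi> [0..<i] = map \<rho> [0..<i]
     then if \<pi> i = \<rho> i then 1 else 1 - (search_dist k r)\<^sup>2 else 0)"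

text \<open>The amplitudes solve \<alpha> - \<beta> = \<open>search_dist k r\<close> and \<alpha> +
  \<beta> = \<open>search_dist k (Suc r)\<close>, so one query advances r by 1. The square root
  fills the norm up to 1.\<close>

definition search_state :: "nat \<Rightarrow> nat \<Rightarrow> nat \<Rightarrow> nat \<Rightarrow> (nat \<Rightarrow> nat) \<Rightarrow> qbasis \<Rightarrow> real" where
  "search_state n k i r \<pi> =
    (let \<alpha> = (search_dist k (Suc r) + search_dist k r) / 2; \<beta> = (search_dist k (Suc r) - search_dist k r) / 2
     in row_state \<pi> i \<alpha> \<beta> (sqrt (1 - \<alpha>\<^sup>2 - (real n - 1) * \<beta>\<^sup>2)) (to_nat (map \<pi> [0..<i])))"

text \<open>This makes the square root in \<open>search_state\<close> genuine, and is where k \<ge>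
  sqrt n enters. With u = 1 - r / k and v = u - 1 / k, the difference \<alpha>^2 - \<beta>^2 is the
  product of the two distances and k \<beta> = (u + v) / 2; the rest is elementary for u, v in
  [0, 1].\<close>

lemma search_amplitudes_le:
  assumes "r < k" "n \<ge> 1" "n \<le> k\<^sup>2"
  defines "\<alpha> \<equiv> (search_dist k (Suc r) + search_dist k r) / 2"
    and "\<beta> \<equiv> (search_dist k (Suc r) - search_dist k r) / 2"
  shows "\<alpha>\<^sup>2 + (real n - 1) * \<beta>\<^sup>2 \<le> 1"
proof -
  define u where "u = 1 - real r / real k"
  define v where "v = 1 - real (Suc r) / real k"
  have k: "real k > 0" using assms by simp
  have u: "0 \<le> u" "u \<le> 1" and v: "0 \<le> v" "v \<le> 1"
    using assms by (auto simp: u_def v_def divide_simps)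
  have uv: "real k * (u - v) = 1" using k by (simp add: u_def v_def field_simps)
  have "real n \<le> (real k)\<^sup>2" using assms(3) by (metis of_nat_le_iff of_nat_power)
  then have "\<alpha>\<^sup>2 + (real n - 1) * \<beta>\<^sup>2 \<le> \<alpha>\<^sup>2 + ((real k)\<^sup>2 - 1) * \<beta>\<^sup>2"
    by (simp add: mult_right_mono)
  also have "\<alpha>\<^sup>2 - \<beta>\<^sup>2 = (1 - u\<^sup>2) * (1 - v\<^sup>2)"
    unfolding \<alpha>_def \<beta>_def search_dist_def u_def[symmetric] v_def[symmetric]
    by (simp add: field_simps power2_eq_square)
  then have "\<alpha>\<^sup>2 + ((real k)\<^sup>2 - 1) * \<beta>\<^sup>2 = (1 - u\<^sup>2) * (1 - v\<^sup>2) + (real k * \<beta>)\<^sup>2"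
    by (simp add: algebra_simps)
  also have "real k * \<beta> = (real k * (u - v)) * (u + v) / 2"
    unfolding \<beta>_def search_dist_def u_def[symmetric] v_def[symmetric]
    by (simp add: field_simps power2_eq_square)
  also have "(real k * (u - v) * (u + v) / 2)\<^sup>2 = (u + v)\<^sup>2 / 4"
    by (simp add: uv power_divide)
  also have "(u + v)\<^sup>2 / 4 \<le> (u\<^sup>2 + v\<^sup>2) / 2"
    using zero_le_power2[of "u - v"] by (simp add: power2_eq_square algebra_simps)
  also have "(1 - u\<^sup>2) * (1 - v\<^sup>2) + (u\<^sup>2 + v\<^sup>2) / 2 \<le> 1"
  proof -
    have "u\<^sup>2 * v\<^sup>2 \<le> u\<^sup>2" "u\<^sup>2 * v\<^sup>2 \<le> v\<^sup>2"
      using u v by (simp_all add: mult_left_le mult_right_le_one_le mult_left_le_one_le power_le_one)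
    then have "u\<^sup>2 * v\<^sup>2 \<le> (u\<^sup>2 + v\<^sup>2) / 2" by (simp add: field_simps)
    then show ?thesis by (simp add: algebra_simps add_divide_distrib)
  qed
  finally show ?thesis by simp
qed

lemma
  assumes "r < k" "n \<le> k\<^sup>2" "i < n" "\<pi> permutes {..<n}" "\<rho> permutes {..<n}"
    and "to_nat (map \<pi> [0..<i]) < w" "to_nat (map \<rho> [0..<i]) < w"
  shows rinner_search_state:
      "rinner (qspace n w) (search_state n k i r \<pi>) (search_state n k i r \<rho>) = search_gram k i r \<pi> \<rho>" (is ?t1)
    and rinner_search_state_queried:
      "rinner (qspace n w) (roracle (perm_mat n \<pi>) (search_state n k i r \<pi>))
        (roracle (perm_mat n \<rho>) (search_state n k i r \<rho>)) = search_gram k i (Suc r) \<pi> \<rho>" (is ?t2)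
proof -
  define \<alpha> where "\<alpha> = (search_dist k (Suc r) + search_dist k r) / 2"
  define \<beta> where "\<beta> = (search_dist k (Suc r) - search_dist k r) / 2"
  define \<gamma> where "\<gamma> = sqrt (1 - \<alpha>\<^sup>2 - (real n - 1) * \<beta>\<^sup>2)"
  have st: "search_state n k i r \<sigma> = row_state \<sigma> i \<alpha> \<beta> \<gamma> (to_nat (map \<sigma> [0..<i]))" for \<sigma>
    by (simp add: search_state_def Let_def \<alpha>_def \<beta>_def \<gamma>_def)
  have \<gamma>: "\<gamma>\<^sup>2 = 1 - \<alpha>\<^sup>2 - (real n - 1) * \<beta>\<^sup>2"
    using search_amplitudes_le[OF assms(1) _ assms(2)] assms(3) by (simp add: \<gamma>_def \<alpha>_def \<beta>_def)
  have ab: "\<alpha> - \<beta> = search_dist k r" "- \<alpha> - \<beta> = - search_dist k (Suc r)"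
    by (simp_all add: \<alpha>_def \<beta>_def field_simps)
  \<comment> \<open>Norm and \<gamma> involve only the square of a, so one computation covers a =
    \<alpha> before the query and a = - \<alpha> after it.\<close>
  have inner: "rinner (qspace n w) (row_state \<pi> i a \<beta> \<gamma> (to_nat (map \<pi> [0..<i])))
      (row_state \<rho> i a \<beta> \<gamma> (to_nat (map \<rho> [0..<i]))) =
    (if map \<pi> [0..<i] = map \<rho> [0..<i] then if \<pi> i = \<rho> i then 1 else 1 - (a - \<beta>)\<^sup>2 else 0)"
    if "a\<^sup>2 = \<alpha>\<^sup>2" for a
    using that assms by (subst rinner_row_state) (simp_all add: sum_two_valued \<gamma> del: map_eq_conv)
  show ?t1 unfolding st using inner[of \<alpha>] by (simp add: ab search_gram_def)
  have "rinner (qspace n w) (roracle (perm_mat n \<pi>) (search_state n k i r \<pi>))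
      (roracle (perm_mat n \<rho>) (search_state n k i r \<rho>)) =
    rinner (qspace n w) (row_state \<pi> i (- \<alpha>) \<beta> \<gamma> (to_nat (map \<pi> [0..<i])))
      (row_state \<rho> i (- \<alpha>) \<beta> \<gamma> (to_nat (map \<rho> [0..<i])))"
    unfolding st by (rule rinner_cong) (use assms in \<open>auto simp: roracle_row_state\<close>)
  then show ?t2 using inner[of "- \<alpha>"] by (simp add: ab search_gram_def)
qed

text \<open>The distance is 1 at r = k and 0 at r = 0: states differing in row i have become
  orthogonal, exactly as if row i were already part of the label.\<close>

lemma search_gram_next_row:
  assumes "k > 0"
  shows "search_gram k i k \<pi> \<rho> = search_gram k (Suc i) 0 \<pi> \<rho>"
  using assms by (auto simp: search_gram_def search_dist_def)

lemma perm_eq_of_map_eq: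
  assumes "\<pi> permutes {..<n}" "\<rho> permutes {..<n}" "map \<pi> [0..<n] = map \<rho> [0..<n]"
  shows "\<pi> = \<rho>"
proof
  fix i show "\<pi> i = \<rho> i"
    using assms by (cases "i < n") (auto simp: permutes_not_in)
qed

lemma quantum_algorithm:
  assumes n: "n \<ge> 1" and kn: "n \<le> k\<^sup>2"
  shows "\<exists>w U f. w > 0 \<and> (\<forall>j\<le>n * k. qunitary n w (U j)) \<and>
     (\<forall>M\<in>perm_matrices n. qprob n w (qrun n w U M (n * k)) f M \<ge> 2 / 3)"
proof -
  let ?P = "{\<pi>. \<pi> permutes {..<n}}"
  define code where "code i \<pi> = to_nat (map \<pi> [0..<i])" for i and \<pi> :: "nat \<Rightarrow> nat"
  have k: "k > 0" using n kn by (cases k) auto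
  have fin: "finite ?P" by (simp add: finite_permutations)
  then have "finite ((\<lambda>(i, \<pi>). code i \<pi>) ` ({..n} \<times> ?P))" by simp
  then obtain w where "\<forall>m \<in> (\<lambda>(i, \<pi>). code i \<pi>) ` ({..n} \<times> ?P). m < w"
    using finite_nat_set_iff_bounded by blast
  then have w: "code i \<pi> < w" if "i \<le> n" "\<pi> permutes {..<n}" for i \<pi>
    using that by auto
  have "w > 0" using w[of 0 id] permutes_id[of "{..<n}"] by simp
  define fin_state where "fin_state \<pi> = (\<lambda>x :: qbasis. if x = ((0, 0), 0, code n \<pi>) then 1 else 0 :: real)" for \<pi>
  \<comment> \<open>State t is the one for query number t mod k to row t div k. At t = n * k no row
    is left; the prescribed Gram matrix is the identity, realized by distinct basis states.\<close>
  define \<phi> where "\<phi> t = (if t < n * k then search_state n k (t div k) (t mod k) else fin_state)" for t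
  have fin_mem: "((0, 0), 0, code n \<pi>) \<in> qspace n w" if "\<pi> permutes {..<n}" for \<pi>
    using n w[OF order_refl that] by (simp add: qspace_def)
  have gram: "rinner (qspace n w) (\<phi> t \<pi>) (\<phi> t \<rho>) = search_gram k (t div k) (t mod k) \<pi> \<rho>"
    if "t \<le> n * k" "\<pi> \<in> ?P" "\<rho> \<in> ?P" for t \<pi> \<rho>
  proof (cases "t < n * k")
    case True
    then have "t div k < n" by (simp add: less_mult_imp_div_less)
    then show ?thesis
      using True that k kn w[of "t div k"] by (simp add: \<phi>_def rinner_search_state code_def)
  next
    case False
    then have t: "t = n * k" using that by simp
    have "code n \<pi> = code n \<rho> \<longleftrightarrow> \<pi> = \<rho>"
      using perm_eq_of_map_eq[of \<pi> n \<rho>] that by (auto simp: code_def simp del: map_eq_conv)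
    then have "rinner (qspace n w) (fin_state \<pi>) (fin_state \<rho>) = (if \<pi> = \<rho> then 1 else 0)"
      using fin_mem[of \<pi>] that
      by (simp add: rinner_def fin_state_def if_distrib[of "\<lambda>t. t * _"] sum.delta cong: if_cong)
    also have "\<dots> = search_gram k n 0 \<pi> \<rho>"
      using perm_eq_of_map_eq[of \<pi> n \<rho>] that by (auto simp: search_gram_def simp del: map_eq_conv)
    finally show ?thesis using t k by (simp add: \<phi>_def)
  qed
  have "\<exists>U. (\<forall>j\<le>n * k. qunitary n w (U j)) \<and>
    (\<forall>j\<le>n * k. \<forall>\<pi>\<in>?P. \<forall>x\<in>qspace n w. qrun n w U (perm_mat n \<pi>) j x = of_real (\<phi> j \<pi> x))"
  proof (rule prescribed_run)
    fix \<pi> \<rho> assume "\<pi> \<in> ?P" "\<rho> \<in> ?P"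
    then show "rinner (qspace n w) (\<phi> 0 \<pi>) (\<phi> 0 \<rho>) = 1"
      by (simp add: gram search_gram_def search_dist_def)
  next
    fix t \<pi> \<rho> assume t: "t < n * k" and P: "\<pi> \<in> ?P" "\<rho> \<in> ?P"
    then have i: "t div k < n" by (simp add: less_mult_imp_div_less)
    have "rinner (qspace n w) (roracle (perm_mat n \<pi>) (\<phi> t \<pi>)) (roracle (perm_mat n \<rho>) (\<phi> t \<rho>)) =
      search_gram k (t div k) (Suc (t mod k)) \<pi> \<rho>"
      using t i P k kn w[of "t div k"] by (simp add: \<phi>_def rinner_search_state_queried code_def)
    \<comment> \<open>Either the same row is continued, or its k queries are used up and the next
      row begins.\<close>
    also have "\<dots> = search_gram k (Suc t div k) (Suc t mod k) \<pi> \<rho>"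
      using k by (simp add: div_Suc mod_Suc search_gram_next_row)
    also have "\<dots> = rinner (qspace n w) (\<phi> (Suc t) \<pi>) (\<phi> (Suc t) \<rho>)"
      using t P by (simp add: gram)
    finally show "rinner (qspace n w) (roracle (perm_mat n \<pi>) (\<phi> t \<pi>)) (roracle (perm_mat n \<rho>) (\<phi> t \<rho>)) =
      rinner (qspace n w) (\<phi> (Suc t) \<pi>) (\<phi> (Suc t) \<rho>)" .
  qed (use fin n \<open>w > 0\<close> in auto)
  then obtain U where U: "\<forall>j\<le>n * k. qunitary n w (U j)"
    "\<And>\<pi> x. \<pi> permutes {..<n} \<Longrightarrow> x \<in> qspace n w \<Longrightarrow> qrun n w U (perm_mat n \<pi>) (n * k) x = of_real (\<phi> (n * k) \<pi> x)"
    by blast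
  define f where "f = (\<lambda>(q :: nat \<times> nat, b :: bit, a). perm_mat n (inv_into ?P (code n) a))"
  have "inj_on (code n) ?P"
    by (rule inj_onI) (auto simp: code_def simp del: map_eq_conv intro: perm_eq_of_map_eq)
  then have f: "f ((0, 0), 0, code n \<pi>) = perm_mat n \<pi>" if "\<pi> permutes {..<n}" for \<pi>
    using that by (simp add: f_def)
  have "qprob n w (qrun n w U (perm_mat n \<pi>) (n * k)) f (perm_mat n \<pi>) \<ge> 2 / 3" if \<pi>: "\<pi> permutes {..<n}" for \<pi>
  proof -
    have "(cmod (qrun n w U (perm_mat n \<pi>) (n * k) ((0, 0), 0, code n \<pi>)))\<^sup>2
      \<le> qprob n w (qrun n w U (perm_mat n \<pi>) (n * k)) f (perm_mat n \<pi>)"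
      unfolding qprob_def by (rule member_le_sum) (use fin_mem[OF \<pi>] f[OF \<pi>] in auto)
    then show ?thesis
      using U(2)[OF \<pi> fin_mem[OF \<pi>]] by (simp add: \<phi>_def fin_state_def)
  qed
  then have "\<forall>M\<in>perm_matrices n. qprob n w (qrun n w U M (n * k)) f M \<ge> 2 / 3"
    unfolding perm_matrices_eq by blast
  then show ?thesis using U(1) \<open>w > 0\<close> by blast
qed

section \<open>Asymptotic bounds\<close>

lemma Q_query_perm_matrices_le:
  assumes "n \<ge> 1" "n \<le> k\<^sup>2"
  shows "Q_query n (perm_matrices n) \<le> n * k"
  unfolding Q_query_def by (rule Least_le) (rule quantum_algorithm[OF assms])

lemma Q_query_perm_matrices_ge:
  assumes "n \<ge> 2"
  shows "real n * sqrt (real n - 1) \<le> 72 * real (Q_query n (perm_matrices n))"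
proof -
  let ?P = "\<lambda>d. \<exists>w U f. w > 0 \<and> (\<forall>k\<le>d. qunitary n w (U k)) \<and>
     (\<forall>M\<in>perm_matrices n. qprob n w (qrun n w U M d) f M \<ge> 2 / 3)"
  \<comment> \<open>Some query count is attainable, so the \<open>LEAST\<close> is attained.\<close>
  have "?P (n * n)"
    using assms by (intro quantum_algorithm) (auto simp: power2_eq_square)
  then have "?P (Q_query n (perm_matrices n))"
    unfolding Q_query_def by (rule LeastI)
  then obtain w U f where w: "w > 0" and U: "\<forall>k\<le>Q_query n (perm_matrices n). qunitary n w (U k)"
    and succ: "\<forall>M\<in>perm_matrices n. qprob n w (qrun n w U M (Q_query n (perm_matrices n))) f M \<ge> 2 / 3"
    by blast
  show ?thesis
  proof (rule quantum_lower_bound[OF assms w])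
    show "qunitary n w (U k)" if "k \<le> Q_query n (perm_matrices n)" for k
      using U that by blast
    show "qprob n w (qrun n w U (perm_mat n \<pi>) (Q_query n (perm_matrices n))) f (perm_mat n \<pi>) \<ge> 2 / 3"
      if "\<pi> permutes {..<n}" for \<pi>
      using succ that unfolding perm_matrices_eq by blast
  qed
qed

lemma R_query_perm_matrices_bigtheta:
  "(\<lambda>n. real (R_query n (perm_matrices n))) \<in> \<Theta>(\<lambda>n. real n ^ 2)"
proof (rule bigthetaI')
  show "\<forall>\<^sub>F n in at_top. 1 / 24 * norm (real n ^ 2) \<le> norm (real (R_query n (perm_matrices n))) \<and>
    norm (real (R_query n (perm_matrices n))) \<le> 1 * norm (real n ^ 2)"
    using eventually_ge_at_top[of 2]
  proof eventually_elim
    case (elim n)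
    have c: "real (n choose 2) = real n * (real n - 1) / 2"
      using elim by (simp add: choose_two real_of_nat_div of_nat_diff)
    have "real n * (real n - 1) / 2 \<le> 6 * real (R_query n (perm_matrices n))"
      using R_query_perm_matrices_ge[of n] by (simp flip: c)
    \<comment> \<open>This gives n - 1 \<ge> n / 2, hence n^2 / 4 \<le> 6 R and the constant
      1/24.\<close>
    moreover have "real n * 2 \<le> real n * real n" using elim by (intro mult_left_mono) auto
    moreover have "real (R_query n (perm_matrices n)) \<le> real n * (real n - 1) / 2"
      using R_query_perm_matrices_le[of n] by (simp flip: c)
    ultimately show ?case by (simp add: power2_eq_square algebra_simps)
  qed
qed auto

lemma Q_query_perm_matrices_bigtheta:
  "(\<lambda>n. real (Q_query n (perm_matrices n))) \<in> \<Theta>(\<lambda>n. real n powr 1.5)"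
proof (rule bigthetaI')
  show "\<forall>\<^sub>F n in at_top. 1 / 144 * norm (real n powr 1.5) \<le> norm (real (Q_query n (perm_matrices n))) \<and>
    norm (real (Q_query n (perm_matrices n))) \<le> 2 * norm (real n powr 1.5)"
    using eventually_ge_at_top[of 2]
  proof eventually_elim
    case (elim n)
    have p: "real n powr 1.5 = real n * sqrt (real n)"
      using elim powr_add[of "real n" 1 "1/2"] by (simp add: powr_half_sqrt)
    define k where "k = nat \<lceil>sqrt (real n)\<rceil>"
    have k: "sqrt (real n) \<le> real k" "real k \<le> sqrt (real n) + 1"
      using real_sqrt_ge_zero[of "real n"] unfolding k_def by linarith+
    have "(sqrt (real n))\<^sup>2 \<le> (real k)\<^sup>2" using k(1) by (intro power_mono) auto
    then have "n \<le> k\<^sup>2" by (simp flip: of_nat_power)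
    then have "Q_query n (perm_matrices n) \<le> n * k"
      using elim by (intro Q_query_perm_matrices_le) auto
    then have "real (Q_query n (perm_matrices n)) \<le> real n * real k"
      by (metis of_nat_le_iff of_nat_mult)
    also have "real k \<le> 2 * sqrt (real n)" using k(2) elim real_sqrt_ge_1_iff[of "real n"] by linarith
    finally have 1: "real (Q_query n (perm_matrices n)) \<le> 2 * (real n * sqrt (real n))"
      by (simp add: mult_left_mono)
    \<comment> \<open>Replacing n - 1 by n costs a factor 2 for n \<ge> 2, hence 144 = 2 *
      72.\<close>
    have "sqrt (real n) \<le> sqrt (4 * (real n - 1))" using elim by (intro real_sqrt_le_mono) auto
    also have "\<dots> = 2 * sqrt (real n - 1)" by (subst real_sqrt_mult) simp
    finally have "real n * sqrt (real n) \<le> real n * (2 * sqrt (real n - 1))" by (intro mult_left_mono) auto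
    then have "real n * sqrt (real n) \<le> 144 * real (Q_query n (perm_matrices n))"
      using Q_query_perm_matrices_ge[OF elim] by linarith
    then show ?case unfolding p using 1 by simp
  qed
qed auto

theorem theorem1p1:
  shows "(\<forall>n\<ge>1. real (D_query n (perm_matrices n)) = real n * (real n - 1) / 2)
    \<and> (\<lambda>n. real (R_query n (perm_matrices n))) \<in> \<Theta>(\<lambda>n. real n ^ 2)
    \<and> (\<lambda>n. real (Q_query n (perm_matrices n))) \<in> \<Theta>(\<lambda>n. real n powr 1.5)"
proof (intro conjI allI impI)
  fix n :: nat assume "n \<ge> 1"
  then show "real (D_query n (perm_matrices n)) = real n * (real n - 1) / 2"
    by (simp add: D_query_perm_matrices choose_two real_of_nat_div of_nat_diff)
qed (fact R_query_perm_matrices_bigtheta Q_query_perm_matrices_bigtheta)+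

end
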